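(* For every $n\geq 1$, the 2-group $\mathbb{A}_n$ is a non-central 2-group extension $$1\to B\mathbb{Z}^{2n}\to\mathbb{A}_n\to\mathrm{O}^{\pm}(n,n,\mathbb{Z})_{dis}\to1,$$ whose induced action of $\mathrm{O}^{\pm}(n,n,\mathbb{Z})$ on $\mathbb{Z}^{2n}$ is $(A,m)\mapsto IAIm$.
   Context: $\mathrm{U}(1)=\mathbb{R}/\mathbb{Z}$ is written additively. $[a,b]=a^{tr}Jb$ on $\mathbb{R}^{2n}$ with $J=\begin{pmatrix}0&0\\ E_n&0\end{pmatrix}$; $I=\begin{pmatrix}0&E_n\\ E_n&0\end{pmatrix}$; $\mathrm{O}^{\pm}(n,n,\mathbb{Z})=\{A\in\mathrm{GL}(2n,\mathbb{Z}):A^{tr}IA=\pm I\}$, and $\mathrm{iso}(A)\in\{\pm1\}$ is the sign with $A^{tr}IA=\mathrm{iso}(A)I$. **The strict 2-group $\mathbb{A}_n$.** Objects are pairs $(A,\eta)$ with $A\in\mathrm{O}^{\pm}(n,n,\mathbb{Z})$ and $\eta:\mathbb{R}^{2n}\times\mathbb{R}^{2n}\to\mathrm{U}(1)$ smooth such that for all $a,a',a''\in\mathbb{R}^{2n}$, $m,m'\in\mathbb{Z}^{2n}$: (A1) $\eta(m,m')=0$; (A2) $\eta(m,a)+\mathrm{iso}(A)[a,m]=\eta(a,m)+[Aa,Am]$; (A3) $\eta(a,a')+\eta(a+a',a'')=\eta(a',a'')+\eta(a,a'+a'')$. Product: $(A_1,\eta_1)\cdot(A_2,\eta_2)=(A_1A_2,\tilde\eta)$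 with $\tilde\eta(a,a')=\eta_1(A_2a,A_2a')+\mathrm{iso}(A_1)\eta_2(a,a')$; unit $(E_{2n},0)$. Morphisms $(A,\eta)\to(A',\eta')$ exist only if $A=A'$ and are then smooth maps $\beta:\mathbb{R}^{2n}\to\mathrm{U}(1)$ with (A4) $\beta(m)=0$ for all $m\in\mathbb{Z}^{2n}$; (A5) $\beta(a_1)+\beta(a_2)+\eta(a_1,a_2)=\eta'(a_1,a_2)+\beta(a_1+a_2)$. Composition is pointwise addition, and the product of $\beta_1:(A_1,\eta_1)\to(A_1,\eta_1')$ and $\beta_2:(A_2,\eta_2)\to(A_2,\eta_2')$ is $(\beta_1\cdot\beta_2)(a)=\beta_1(A_2a)+\mathrm{iso}(A_1)\beta_2(a)$. **Extensions.** $G_{dis}$ is the 2-group with objects $G$ and only identity morphisms; $BA$ has one object with automorphism group $A$. A strict 2-group extension $BA\to\Gamma\to G_{dis}$ consists of 2-group homomorphisms such that $\Gamma_0\to G$ is the projection $\Gamma_0\to\pi_0\Gamma$ (isomorphism classes of objects) followed by an isomorphism $\pi_0\Gamma\cong G$, and $A\cong\pi_1\Gamma=\mathrm{Aut}(1)$. Its induced action of $G$ on $A$ is $\alpha(g,a)=\mathrm{id}_{\tilde g}\cdot a\cdot\mathrm{id}_{\tilde g^{-1}}$, with $\tilde g$ any object over $g$; it is central if $\alpha$ is trivial. Here the projection is $(A,\eta)\mapsto A$, and $\mathbb{Z}^{2n}\cong\mathrm{Aut}(E_{2n},0)=\mathrm{Hom}^\infty(\mathbb{T}^{2n},\mathrm{U}(1))$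 via $m\mapsto(a\mapsto m\cdot a \bmod\mathbb{Z})$, where $\mathbb{T}^{2n}=\mathbb{R}^{2n}/\mathbb{Z}^{2n}$. *)

theory Defs
  imports "HOL-Analysis.Analysis" "HOL-Algebra.Elementary_Groups"
begin

quotient_type u1 = real / "\<lambda>x y :: real. x - y \<in> \<int>"
  morphisms rep_u1 mod_Z
proof (rule equivpI)
  show "reflp (\<lambda>x y :: real. x - y \<in> \<int>)"
    by (simp add: reflp_def)
  show "symp (\<lambda>x y :: real. x - y \<in> \<int>)"
  proof (rule sympI)
    fix x y :: real
    assume "x - y \<in> \<int>"
    then have "- (x - y) \<in> \<int>" by (rule Ints_minus)
    then show "y - x \<in> \<int>" by simp
  qed
  show "transp (\<lambda>x y :: real. x - y \<in> \<int>)"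
  proof (rule transpI)
    fix x y z :: real
    assume "x - y \<in> \<int>" "y - z \<in> \<int>"
    then have "(x - y) + (y - z) \<in> \<int>" by (rule Ints_add)
    then show "x - z \<in> \<int>" by simp
  qed
qed

instantiation u1 :: ab_group_add
begin

lift_definition zero_u1 :: u1 is 0 .

lift_definition plus_u1 :: "u1 \<Rightarrow> u1 \<Rightarrow> u1" is "(+)"
  by (simp add: add_diff_add Ints_add)

lift_definition uminus_u1 :: "u1 \<Rightarrow> u1" is "uminus"
  by (simp only: minus_diff_minus Ints_minus)

lift_definition minus_u1 :: "u1 \<Rightarrow> u1 \<Rightarrow> u1" is "(-)"
proof -
  fix x x' y y' :: real
  assume "x - x' \<in> \<int>" "y - y' \<in> \<int>"
  then have "(x - x') - (y - y') \<in> \<int>" by (rule Ints_diff)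
  then show "(x - y) - (x' - y') \<in> \<int>" by (simp add: algebra_simps)
qed

instance
  by standard (transfer; simp)+

end

lift_definition zscale :: "int \<Rightarrow> u1 \<Rightarrow> u1" (infixr \<open>*\<^sub>Z\<close> 75)
  is "\<lambda>k x. of_int k * x"
  by (simp only: right_diff_distrib[symmetric] Ints_mult Ints_of_int)

text \<open>For open \<open>S\<close>, \<open>C_on k S f\<close> says that \<open>f\<close> is \<open>k\<close> times continuously differentiable on \<open>S\<close>:
  \<open>f\<close> is differentiable and all its directional derivatives are of class \<open>k - 1\<close>
  (in finite dimension this is the usual notion).\<close>

primrec C_on :: "nat \<Rightarrow> 'a::euclidean_space set \<Rightarrow> ('a \<Rightarrow> real) \<Rightarrow> bool" where
  "C_on 0 S f \<longleftrightarrow> continuous_on S f"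
| "C_on (Suc k) S f \<longleftrightarrow>
     (\<forall>x\<in>S. f differentiable (at x)) \<and> (\<forall>v. C_on k S (\<lambda>x. frechet_derivative f (at x) v))"

definition smooth_real_on :: "'a::euclidean_space set \<Rightarrow> ('a \<Rightarrow> real) \<Rightarrow> bool" where
  "smooth_real_on S f \<longleftrightarrow> (\<forall>k. C_on k S f)"

text \<open>The local inverses of \<open>mod_Z\<close> are the charts of the circle, so a map into the circle is smooth
  iff it lifts locally to smooth real-valued functions.\<close>

definition smooth_u1 :: "('a::euclidean_space \<Rightarrow> u1) \<Rightarrow> bool" where
  "smooth_u1 f \<longleftrightarrow>
     (\<forall>x. \<exists>U g. open U \<and> x \<in> U \<and> smooth_real_on U g \<and> (\<forall>y\<in>U. f y = mod_Z (g y)))"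

text \<open>A strict 2-group is a group object in small groupoids: objects and morphisms form groups,
  the two multiplications being the tensor product. \<open>cmp \<Gamma> g f\<close> is the composite ``\<open>g\<close> after \<open>f\<close>'';
  it is meaningful only if \<open>tgt \<Gamma> f = src \<Gamma> g\<close>.\<close>

record ('o, 'm) two_group =
  Obj :: "'o monoid"
  Mor :: "'m monoid"
  src :: "'m \<Rightarrow> 'o"
  tgt :: "'m \<Rightarrow> 'o"
  idm :: "'o \<Rightarrow> 'm"
  cmp :: "'m \<Rightarrow> 'm \<Rightarrow> 'm"

locale strict_2_group =
  fixes \<Gamma> :: "('o, 'm) two_group"
  assumes group_Obj: "group (Obj \<Gamma>)"
    and group_Mor: "group (Mor \<Gamma>)"
    and src_hom: "src \<Gamma> \<in> hom (Mor \<Gamma>) (Obj \<Gamma>)"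
    and tgt_hom: "tgt \<Gamma> \<in> hom (Mor \<Gamma>) (Obj \<Gamma>)"
    and idm_hom: "idm \<Gamma> \<in> hom (Obj \<Gamma>) (Mor \<Gamma>)"
    and src_idm: "x \<in> carrier (Obj \<Gamma>) \<Longrightarrow> src \<Gamma> (idm \<Gamma> x) = x"
    and tgt_idm: "x \<in> carrier (Obj \<Gamma>) \<Longrightarrow> tgt \<Gamma> (idm \<Gamma> x) = x"
    and cmp_closed: "\<lbrakk>f \<in> carrier (Mor \<Gamma>); g \<in> carrier (Mor \<Gamma>); tgt \<Gamma> f = src \<Gamma> g\<rbrakk>
          \<Longrightarrow> cmp \<Gamma> g f \<in> carrier (Mor \<Gamma>)"
    and src_cmp: "\<lbrakk>f \<in> carrier (Mor \<Gamma>); g \<in> carrier (Mor \<Gamma>); tgt \<Gamma> f = src \<Gamma> g\<rbrakk>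
          \<Longrightarrow> src \<Gamma> (cmp \<Gamma> g f) = src \<Gamma> f"
    and tgt_cmp: "\<lbrakk>f \<in> carrier (Mor \<Gamma>); g \<in> carrier (Mor \<Gamma>); tgt \<Gamma> f = src \<Gamma> g\<rbrakk>
          \<Longrightarrow> tgt \<Gamma> (cmp \<Gamma> g f) = tgt \<Gamma> g"
    and cmp_assoc: "\<lbrakk>f \<in> carrier (Mor \<Gamma>); g \<in> carrier (Mor \<Gamma>); h \<in> carrier (Mor \<Gamma>);
            tgt \<Gamma> f = src \<Gamma> g; tgt \<Gamma> g = src \<Gamma> h\<rbrakk>
          \<Longrightarrow> cmp \<Gamma> h (cmp \<Gamma> g f) = cmp \<Gamma> (cmp \<Gamma> h g) f"
    and cmp_idm_right: "f \<in> carrier (Mor \<Gamma>) \<Longrightarrow> cmp \<Gamma> f (idm \<Gamma> (src \<Gamma> f)) = f"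
    and cmp_idm_left: "f \<in> carrier (Mor \<Gamma>) \<Longrightarrow> cmp \<Gamma> (idm \<Gamma> (tgt \<Gamma> f)) f = f"
    and cmp_inverse: "f \<in> carrier (Mor \<Gamma>) \<Longrightarrow>
          \<exists>g \<in> carrier (Mor \<Gamma>). src \<Gamma> g = tgt \<Gamma> f \<and> tgt \<Gamma> g = src \<Gamma> f \<and>
            cmp \<Gamma> g f = idm \<Gamma> (src \<Gamma> f) \<and> cmp \<Gamma> f g = idm \<Gamma> (tgt \<Gamma> f)"
    and interchange: "\<lbrakk>f \<in> carrier (Mor \<Gamma>); g \<in> carrier (Mor \<Gamma>); tgt \<Gamma> f = src \<Gamma> g;
            f' \<in> carrier (Mor \<Gamma>); g' \<in> carrier (Mor \<Gamma>); tgt \<Gamma> f' = src \<Gamma> g'\<rbrakk>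
          \<Longrightarrow> cmp \<Gamma> (g \<otimes>\<^bsub>Mor \<Gamma>\<^esub> g') (f \<otimes>\<^bsub>Mor \<Gamma>\<^esub> f') = cmp \<Gamma> g f \<otimes>\<^bsub>Mor \<Gamma>\<^esub> cmp \<Gamma> g' f'"

record ('o, 'm, 'p, 'q) two_group_map =
  on_obj :: "'o \<Rightarrow> 'p"
  on_mor :: "'m \<Rightarrow> 'q"

locale strict_2_group_hom = dom: strict_2_group \<Gamma> + cod: strict_2_group \<Delta>
  for \<Gamma> :: "('o, 'm) two_group" and \<Delta> :: "('p, 'q) two_group" +
  fixes F :: "('o, 'm, 'p, 'q) two_group_map"
  assumes on_obj_hom: "on_obj F \<in> hom (Obj \<Gamma>) (Obj \<Delta>)"
    and on_mor_hom: "on_mor F \<in> hom (Mor \<Gamma>) (Mor \<Delta>)"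
    and map_src: "f \<in> carrier (Mor \<Gamma>) \<Longrightarrow> src \<Delta> (on_mor F f) = on_obj F (src \<Gamma> f)"
    and map_tgt: "f \<in> carrier (Mor \<Gamma>) \<Longrightarrow> tgt \<Delta> (on_mor F f) = on_obj F (tgt \<Gamma> f)"
    and map_idm: "x \<in> carrier (Obj \<Gamma>) \<Longrightarrow> on_mor F (idm \<Gamma> x) = idm \<Delta> (on_obj F x)"
    and map_cmp: "\<lbrakk>f \<in> carrier (Mor \<Gamma>); g \<in> carrier (Mor \<Gamma>); tgt \<Gamma> f = src \<Gamma> g\<rbrakk>
          \<Longrightarrow> on_mor F (cmp \<Gamma> g f) = cmp \<Delta> (on_mor F g) (on_mor F f)"

definition discrete_2_group :: "'g monoid \<Rightarrow> ('g, 'g) two_group" where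
  "discrete_2_group G =
     \<lparr>Obj = G, Mor = G, src = (\<lambda>g. g), tgt = (\<lambda>g. g), idm = (\<lambda>g. g), cmp = (\<lambda>g f. f)\<rparr>"

definition B_2_group :: "'a monoid \<Rightarrow> (unit, 'a) two_group" where
  "B_2_group A =
     \<lparr>Obj = singleton_group (), Mor = A, src = (\<lambda>_. ()), tgt = (\<lambda>_. ()),
      idm = (\<lambda>_. \<one>\<^bsub>A\<^esub>), cmp = (\<lambda>g f. g \<otimes>\<^bsub>A\<^esub> f)\<rparr>"

definition iso_rel :: "('o, 'm) two_group \<Rightarrow> ('o \<times> 'o) set" where
  "iso_rel \<Gamma> = {(x, y). x \<in> carrier (Obj \<Gamma>) \<and> y \<in> carrier (Obj \<Gamma>) \<and>
     (\<exists>f \<in> carrier (Mor \<Gamma>). src \<Gamma> f = x \<and> tgt \<Gamma> f = y)}"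

definition pi0 :: "('o, 'm) two_group \<Rightarrow> 'o set monoid" where
  "pi0 \<Gamma> =
     \<lparr>carrier = carrier (Obj \<Gamma>) // iso_rel \<Gamma>,
      monoid.mult = (\<lambda>c d. \<Union>x\<in>c. \<Union>y\<in>d. iso_rel \<Gamma> `` {x \<otimes>\<^bsub>Obj \<Gamma>\<^esub> y}),
      one = iso_rel \<Gamma> `` {\<one>\<^bsub>Obj \<Gamma>\<^esub>}\<rparr>"

definition Aut_group :: "('o, 'm) two_group \<Rightarrow> 'o \<Rightarrow> 'm monoid" where
  "Aut_group \<Gamma> x =
     \<lparr>carrier = {f \<in> carrier (Mor \<Gamma>). src \<Gamma> f = x \<and> tgt \<Gamma> f = x},
      monoid.mult = cmp \<Gamma>, one = idm \<Gamma> x\<rparr>"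

definition pi1 :: "('o, 'm) two_group \<Rightarrow> 'm monoid" where
  "pi1 \<Gamma> = Aut_group \<Gamma> \<one>\<^bsub>Obj \<Gamma>\<^esub>"

locale strict_2_group_extension =
  inclusion: strict_2_group_hom "B_2_group A" \<Gamma> F +
  projection: strict_2_group_hom \<Gamma> "discrete_2_group G" P
  for A :: "'a monoid" and \<Gamma> :: "('o, 'm) two_group" and G :: "'g monoid"
    and F :: "(unit, 'a, 'o, 'm) two_group_map" and P :: "('o, 'm, 'g, 'g) two_group_map" +
  assumes comm_group_A: "comm_group A"
    and group_G: "group G"
    and pi1_iso: "on_mor F \<in> iso A (pi1 \<Gamma>)"
    and pi0_iso: "\<exists>\<phi> \<in> iso (pi0 \<Gamma>) G. \<forall>x \<in> carrier (Obj \<Gamma>). on_obj P x = \<phi> (iso_rel \<Gamma> `` {x})"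

text \<open>\<open>A\<close> is identified with the automorphism group of the unit along \<open>F\<close>. The description says in
  particular that the result is the same for every object \<open>x\<close> over \<open>g\<close>.\<close>

definition induced_action ::
  "'a monoid \<Rightarrow> ('o, 'm) two_group \<Rightarrow> (unit, 'a, 'o, 'm) two_group_map \<Rightarrow>
   ('o, 'm, 'g, 'g) two_group_map \<Rightarrow> 'g \<Rightarrow> 'a \<Rightarrow> 'a" where
  "induced_action A \<Gamma> F P g a =
     (THE b. b \<in> carrier A \<and>
        (\<forall>x \<in> carrier (Obj \<Gamma>). on_obj P x = g \<longrightarrow>
           on_mor F b =
             idm \<Gamma> x \<otimes>\<^bsub>Mor \<Gamma>\<^esub> on_mor F a \<otimes>\<^bsub>Mor \<Gamma>\<^esub> idm \<Gamma> (inv\<^bsub>Obj \<Gamma>\<^esub> x)))"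

definition central_extension ::
  "'a monoid \<Rightarrow> ('o, 'm) two_group \<Rightarrow> 'g monoid \<Rightarrow> (unit, 'a, 'o, 'm) two_group_map \<Rightarrow>
   ('o, 'm, 'g, 'g) two_group_map \<Rightarrow> bool" where
  "central_extension A \<Gamma> G F P \<longleftrightarrow>
     strict_2_group_extension A \<Gamma> G F P \<and>
     (\<forall>g \<in> carrier G. \<forall>a \<in> carrier A. induced_action A \<Gamma> F P g a = a)"

text \<open>Vectors of length \<open>2n\<close> are indexed by \<open>'n + 'n\<close> with \<open>n = CARD('n)\<close>.\<close>

type_synonym 'n rvec = "real ^ ('n + 'n)"
type_synonym 'n ivec = "int ^ ('n + 'n)"
type_synonym 'n imat = "int ^ ('n + 'n) ^ ('n + 'n)"

definition block_matrix ::
  "'a ^ 'n ^ 'n \<Rightarrow> 'a ^ 'n ^ 'n \<Rightarrow> 'a ^ 'n ^ 'n \<Rightarrow> 'a ^ 'n ^ 'n \<Rightarrow> 'a ^ ('n + 'n) ^ ('n::finite + 'n)" where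
  "block_matrix A B C D =
     (\<chi> i j. case i of
        Inl k \<Rightarrow> (case j of Inl l \<Rightarrow> A $ k $ l | Inr l \<Rightarrow> B $ k $ l)
      | Inr k \<Rightarrow> (case j of Inl l \<Rightarrow> C $ k $ l | Inr l \<Rightarrow> D $ k $ l))"

definition J_mat :: "real ^ ('n + 'n) ^ ('n::finite + 'n)" where
  "J_mat = block_matrix 0 0 (mat 1) 0"

definition I_mat :: "'n::finite imat" where
  "I_mat = block_matrix 0 (mat 1) (mat 1) 0"

definition bracket :: "'n::finite rvec \<Rightarrow> 'n rvec \<Rightarrow> real" where
  "bracket a b = a \<bullet> (J_mat *v b)"

definition real_vec :: "'n::finite ivec \<Rightarrow> 'n rvec" where
  "real_vec m = (\<chi> i. of_int (m $ i))"

definition real_mat :: "'n::finite imat \<Rightarrow> real ^ ('n + 'n) ^ ('n + 'n)" where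
  "real_mat A = (\<chi> i j. of_int (A $ i $ j))"

definition O_pm :: "'n::finite imat monoid" where
  "O_pm = \<lparr>carrier = {A. invertible A \<and>
             (transpose A ** I_mat ** A = I_mat \<or> transpose A ** I_mat ** A = - I_mat)},
           monoid.mult = (**), one = mat 1\<rparr>"

definition iso_sign :: "'n::finite imat \<Rightarrow> int" where
  "iso_sign A = (if transpose A ** I_mat ** A = I_mat then 1 else -1)"

definition Z_group :: "'n::finite ivec monoid" where
  "Z_group = \<lparr>carrier = UNIV, monoid.mult = (+), one = 0\<rparr>"

type_synonym 'n AA_obj = "'n imat \<times> ('n rvec \<times> 'n rvec \<Rightarrow> u1)"

text \<open>A morphism is recorded as (source, \<open>\<beta>\<close>, target).\<close>

type_synonym 'n AA_mor = "'n AA_obj \<times> ('n rvec \<Rightarrow> u1) \<times> 'n AA_obj"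

type_synonym 'n AA_2_group = "('n AA_obj, 'n AA_mor) two_group"

definition is_AA_obj :: "'n::finite AA_obj \<Rightarrow> bool" where
  "is_AA_obj = (\<lambda>(A, \<eta>).
     A \<in> carrier O_pm \<and> smooth_u1 \<eta> \<and>
     (\<forall>m m'. \<eta> (real_vec m, real_vec m') = 0) \<and>
     (\<forall>a m. \<eta> (real_vec m, a) + mod_Z (of_int (iso_sign A) * bracket a (real_vec m)) =
            \<eta> (a, real_vec m) + mod_Z (bracket (real_mat A *v a) (real_mat A *v real_vec m))) \<and>
     (\<forall>a a' a''. \<eta> (a, a') + \<eta> (a + a', a'') = \<eta> (a', a'') + \<eta> (a, a' + a'')))"

definition is_AA_mor :: "'n::finite AA_mor \<Rightarrow> bool" where
  "is_AA_mor = (\<lambda>((A, \<eta>), \<beta>, (A', \<eta>')).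
     is_AA_obj (A, \<eta>) \<and> is_AA_obj (A', \<eta>') \<and> A = A' \<and> smooth_u1 \<beta> \<and>
     (\<forall>m. \<beta> (real_vec m) = 0) \<and>
     (\<forall>a\<^sub>1 a\<^sub>2. \<beta> a\<^sub>1 + \<beta> a\<^sub>2 + \<eta> (a\<^sub>1, a\<^sub>2) = \<eta>' (a\<^sub>1, a\<^sub>2) + \<beta> (a\<^sub>1 + a\<^sub>2)))"

definition AA_obj_mult :: "'n::finite AA_obj \<Rightarrow> 'n AA_obj \<Rightarrow> 'n AA_obj" where
  "AA_obj_mult = (\<lambda>(A\<^sub>1, \<eta>\<^sub>1) (A\<^sub>2, \<eta>\<^sub>2).
     (A\<^sub>1 ** A\<^sub>2,
      \<lambda>(a, a'). \<eta>\<^sub>1 (real_mat A\<^sub>2 *v a, real_mat A\<^sub>2 *v a') + iso_sign A\<^sub>1 *\<^sub>Z \<eta>\<^sub>2 (a, a')))"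

definition AA_mor_mult :: "'n::finite AA_mor \<Rightarrow> 'n AA_mor \<Rightarrow> 'n AA_mor" where
  "AA_mor_mult = (\<lambda>(x\<^sub>1, \<beta>\<^sub>1, y\<^sub>1) (x\<^sub>2, \<beta>\<^sub>2, y\<^sub>2).
     (AA_obj_mult x\<^sub>1 x\<^sub>2,
      \<lambda>a. \<beta>\<^sub>1 (real_mat (fst x\<^sub>2) *v a) + iso_sign (fst x\<^sub>1) *\<^sub>Z \<beta>\<^sub>2 a,
      AA_obj_mult y\<^sub>1 y\<^sub>2))"

definition AA_one :: "'n::finite AA_obj" where
  "AA_one = (mat 1, \<lambda>_. 0)"

definition AA_idm :: "'n::finite AA_obj \<Rightarrow> 'n AA_mor" where
  "AA_idm x = (x, \<lambda>_. 0, x)"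

definition AA :: "'n::finite AA_2_group" where
  "AA =
     \<lparr>Obj = \<lparr>carrier = {x. is_AA_obj x}, monoid.mult = AA_obj_mult, one = AA_one\<rparr>,
      Mor = \<lparr>carrier = {f. is_AA_mor f}, monoid.mult = AA_mor_mult, one = AA_idm AA_one\<rparr>,
      src = (\<lambda>(x, \<beta>, y). x),
      tgt = (\<lambda>(x, \<beta>, y). y),
      idm = AA_idm,
      cmp = (\<lambda>(y, \<beta>', z) (x, \<beta>, y'). (x, \<lambda>a. \<beta>' a + \<beta> a, z))\<rparr>"

definition AA_incl :: "(unit, 'n::finite ivec, 'n AA_obj, 'n AA_mor) two_group_map" where
  "AA_incl =
     \<lparr>on_obj = (\<lambda>_. AA_one),
      on_mor = (\<lambda>m. (AA_one, \<lambda>a. mod_Z (real_vec m \<bullet> a), AA_one))\<rparr>"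

definition AA_proj :: "('n::finite AA_obj, 'n AA_mor, 'n imat, 'n imat) two_group_map" where
  "AA_proj = \<lparr>on_obj = (\<lambda>(A, \<eta>). A), on_mor = (\<lambda>((A, \<eta>), \<beta>, y). A)\<rparr>"

end

theory Submission
  imports Defs
begin

text \<open>Everything that can be checked by composing formulas, namely that objects and morphisms form groups and
  that the interchange law holds, is a direct computation with the axioms. The content of the theorem is
  the computation of the two homotopy groups, and it rests on lifting circle-valued functions on a vector
  space to real-valued ones (\<open>smooth_u1_lift\<close>).

  Every matrix in the group is the first component of an object (\<open>AA_obj_exists\<close>): the axioms ask for a
  cocycle \<open>\<eta>\<close> whose antisymmetrization on lattice vectors is the form \<open>[Aa,Ab] - \<epsilon>[a,b]\<close>, where
  \<open>\<epsilon> = \<plusminus>1\<close> is the sign of \<open>A\<close>. Since the symmetrization of the bracket is the form \<open>I\<close>, and \<open>A\<close>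
  multiplies \<open>I\<close> by \<open>\<epsilon>\<close>, this form is skew and integral, so it is the antisymmetrization of an integral
  bilinear form, the strictly triangular half of its matrix.

  Two objects with the same matrix are isomorphic (\<open>AA_isomorphic_iff\<close>): their difference is a smooth cocycle that
  is trivial on the lattice and symmetric as soon as one argument lies in the lattice. Its real lift is a
  cocycle whose antisymmetrization is bilinear and integral on the lattice in one variable, hence zero; and
  a symmetric smooth real cocycle is the coboundary of a smooth function, found by integrating a one-form
  along rays (\<open>smooth_symmetric_cocycle_is_coboundary\<close>). A linear correction makes this function vanish
  on the lattice modulo \<open>\<int>\<close>. Hence the classes of objects form the matrix group.

  The automorphisms of the unit are the smooth characters that are trivial on the lattice; their lifts are
  additive, therefore linear, with integer coefficients (\<open>smooth_u1_hom_vanishing_on_lattice\<close>).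

  Conjugating the character \<open>a \<mapsto> m \<cdot> a\<close> by an object over \<open>A\<close> gives \<open>a \<mapsto> \<epsilon> m \<cdot> A\<inverse>a\<close>
  (\<open>conjugate_character\<close>), and \<open>A\<^sup>t I A = \<epsilon> I\<close> rewrites \<open>\<epsilon>\<close> times the inverse transpose of \<open>A\<close> as \<open>I A I\<close>.
  The matrix \<open>- E\<close> acts by \<open>m \<mapsto> - m\<close>, so the extension is not central.\<close>

section \<open>Calculus of smooth real functions\<close>

lemma C_on_cong_open:
  assumes "open S" "C_on k S f" "\<And>x. x \<in> S \<Longrightarrow> f x = g x"
  shows "C_on k S g"
  using assms(2,3)
proof (induction k arbitrary: f g)
  case 0
  then show ?case using continuous_on_eq unfolding C_on.simps(1) by blast
next
  case (Suc k)
  have diff: "f differentiable (at x)" if "x \<in> S" for x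
    using Suc.prems(1) that by simp
  have D: "(g has_derivative frechet_derivative f (at x)) (at x)" if "x \<in> S" for x
    by (rule has_derivative_transform_within_open
          [OF diff[OF that, unfolded frechet_derivative_works] \<open>open S\<close> that Suc.prems(2)])
  show ?case
    unfolding C_on.simps(2)
  proof (intro conjI ballI allI)
    show "g differentiable (at x)" if "x \<in> S" for x
      using D[OF that] unfolding differentiable_def by blast
    show "C_on k S (\<lambda>x. frechet_derivative g (at x) v)" for v
    proof (rule Suc.IH)
      show "C_on k S (\<lambda>x. frechet_derivative f (at x) v)"
        using Suc.prems(1) unfolding C_on.simps(2) by blast
      show "frechet_derivative f (at x) v = frechet_derivative g (at x) v" if "x \<in> S" for x
        by (simp only: frechet_derivative_at[OF D[OF that]])
    qed
  qed
qed

text \<open>The definition of \<^const>\<open>C_on\<close> speaks of \<^const>\<open>frechet_derivative\<close>, a choice operator;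
  this rule allows any explicit formula for the derivative instead.\<close>

lemma C_on_SucI:
  assumes "open S" "\<And>x. x \<in> S \<Longrightarrow> (f has_derivative f' x) (at x)" "\<And>v. C_on k S (\<lambda>x. f' x v)"
  shows "C_on (Suc k) S f"
  unfolding C_on.simps(2)
proof (intro conjI ballI allI)
  show "f differentiable (at x)" if "x \<in> S" for x
    using assms(2)[OF that] unfolding differentiable_def by blast
  show "C_on k S (\<lambda>x. frechet_derivative f (at x) v)" for v
  proof (rule C_on_cong_open[OF assms(1) assms(3)[of v]])
    show "f' x v = frechet_derivative f (at x) v" if "x \<in> S" for x
      by (simp only: frechet_derivative_at[OF assms(2)[OF that]])
  qed
qed

lemma C_on_Suc_has_derivative:
  "C_on (Suc k) S f \<Longrightarrow> x \<in> S \<Longrightarrow> (f has_derivative frechet_derivative f (at x)) (at x)"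
  unfolding C_on.simps(2) using frechet_derivative_works by blast

lemma C_on_Suc_lower: "C_on (Suc k) S f \<Longrightarrow> C_on k S f"
proof (induction k arbitrary: f)
  case 0
  then show ?case
    by (simp add: continuous_at_imp_continuous_on differentiable_imp_continuous_within)
next
  case (Suc k)
  have *: "\<forall>x\<in>S. f differentiable (at x)"
      "\<And>v. C_on (Suc k) S (\<lambda>x. frechet_derivative f (at x) v)"
    using Suc.prems[unfolded C_on.simps(2)[of "Suc k" S f]] by blast+
  show ?case
    unfolding C_on.simps(2)[of k] using *(1) Suc.IH[OF *(2)] by blast
qed

lemma C_on_subset: "C_on k S f \<Longrightarrow> T \<subseteq> S \<Longrightarrow> C_on k T f"
  by (induction k arbitrary: f) (auto intro: continuous_on_subset)

lemma C_on_local: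
  assumes "open S" "\<And>x. x \<in> S \<Longrightarrow> \<exists>U. open U \<and> x \<in> U \<and> C_on k U f"
  shows "C_on k S f"
  using assms(2)
proof (induction k arbitrary: f)
  case 0
  have "continuous (at x) f" if "x \<in> S" for x
    using 0[OF that] by (auto simp: continuous_on_eq_continuous_at)
  then show ?case by (simp add: continuous_at_imp_continuous_on)
next
  case (Suc k)
  show ?case
    unfolding C_on.simps(2)
  proof (intro conjI allI)
    show "\<forall>x\<in>S. f differentiable (at x)"
      using Suc.prems unfolding C_on.simps(2) by blast
    show "C_on k S (\<lambda>x. frechet_derivative f (at x) v)" for v
    proof (rule Suc.IH)
      fix x assume "x \<in> S"
      with Suc.prems show "\<exists>U. open U \<and> x \<in> U \<and> C_on k U (\<lambda>x. frechet_derivative f (at x) v)"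
        unfolding C_on.simps(2) by blast
    qed
  qed
qed

lemma C_on_const: "open S \<Longrightarrow> C_on k S (\<lambda>_. c)"
  by (induction k arbitrary: c)
    (simp, rule C_on_SucI[where f' = "\<lambda>_ _. 0"], auto)

lemma C_on_bounded_linear:
  assumes "open S" "bounded_linear f"
  shows "C_on k S f"
proof (cases k)
  case 0
  then show ?thesis using assms by (simp add: linear_continuous_on)
next
  case (Suc j)
  have "C_on (Suc j) S f"
    using assms
    by (intro C_on_SucI[where f' = "\<lambda>_. f"] C_on_const) (auto intro: bounded_linear_imp_has_derivative)
  then show ?thesis using Suc by simp
qed

lemma C_on_add:
  assumes "open S"
  shows "C_on k S f \<Longrightarrow> C_on k S g \<Longrightarrow> C_on k S (\<lambda>x. f x + g x)"
proof (induction k arbitrary: f g)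
  case 0
  then show ?case by (auto intro: continuous_intros)
next
  case (Suc k)
  show ?case
  proof (rule C_on_SucI[OF assms])
    show "((\<lambda>x. f x + g x) has_derivative
        (\<lambda>v. frechet_derivative f (at x) v + frechet_derivative g (at x) v)) (at x)" if "x \<in> S" for x
      using Suc.prems that by (intro has_derivative_add C_on_Suc_has_derivative)
    show "C_on k S (\<lambda>x. frechet_derivative f (at x) v + frechet_derivative g (at x) v)" for v
      using Suc.prems by (intro Suc.IH) simp_all
  qed
qed

text \<open>The product rule reintroduces the undifferentiated factors, so the induction needs them at the lower
  order as well; this is what \<open>C_on_Suc_lower\<close> provides.\<close>

lemma C_on_mult:
  assumes "open S"
  shows "C_on k S f \<Longrightarrow> C_on k S g \<Longrightarrow> C_on k S (\<lambda>x. f x * g x)"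
proof (induction k arbitrary: f g)
  case 0
  then show ?case by (auto intro: continuous_intros)
next
  case (Suc k)
  show ?case
  proof (rule C_on_SucI[OF assms])
    show "((\<lambda>x. f x * g x) has_derivative
        (\<lambda>v. f x * frechet_derivative g (at x) v + frechet_derivative f (at x) v * g x)) (at x)"
      if "x \<in> S" for x
      using Suc.prems that by (intro has_derivative_mult C_on_Suc_has_derivative)
    show "C_on k S (\<lambda>x. f x * frechet_derivative g (at x) v + frechet_derivative f (at x) v * g x)" for v
      using Suc.prems Suc.prems[THEN C_on_Suc_lower]
      by (intro C_on_add[OF assms] Suc.IH) simp_all
  qed
qed

text \<open>Linear substitutions are needed for \<open>\<eta>\<^sub>1 (A\<^sub>2 a, A\<^sub>2 a')\<close>, and translations for freezing one argument of a
  function of two variables. For affine maps the chain rule stays within the class: the derivative in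
  direction \<open>v\<close> is again a derivative of \<open>f\<close>, in the constant direction \<open>L v\<close>.\<close>

lemma C_on_compose_affine:
  assumes "open S" "bounded_linear L"
  shows "C_on k S f \<Longrightarrow> C_on k ((\<lambda>x. L x + p) -` S) (\<lambda>x. f (L x + p))"
proof (induction k arbitrary: f)
  case 0
  have "continuous_on ((\<lambda>x. L x + p) -` S) (\<lambda>x. L x + p)"
    by (intro continuous_on_add continuous_on_const linear_continuous_on assms(2))
  with 0 show ?case
    using continuous_on_compose2[of S f "(\<lambda>x. L x + p) -` S" "\<lambda>x. L x + p"] by auto
next
  case (Suc k)
  have op: "open ((\<lambda>x. L x + p) -` S)"
    by (intro open_vimage assms(1) continuous_on_add continuous_on_const linear_continuous_on assms(2))
  show ?case
  proof (rule C_on_SucI[OF op])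
    show "((\<lambda>x. f (L x + p)) has_derivative (\<lambda>v. frechet_derivative f (at (L x + p)) (L v))) (at x)"
      if "x \<in> (\<lambda>x. L x + p) -` S" for x
    proof (rule has_derivative_compose[where f = "\<lambda>x. L x + p"])
      show "((\<lambda>x. L x + p) has_derivative L) (at x)"
        by (intro has_derivative_add_const bounded_linear_imp_has_derivative assms(2))
      show "(f has_derivative frechet_derivative f (at (L x + p))) (at (L x + p))"
        using that by (intro C_on_Suc_has_derivative[OF Suc.prems]) simp
    qed
    show "C_on k ((\<lambda>x. L x + p) -` S) (\<lambda>x. frechet_derivative f (at (L x + p)) (L v))" for v
      using Suc.prems Suc.IH[of "\<lambda>y. frechet_derivative f (at y) (L v)"] by simp
  qed
qed

lemma smooth_real_on_cong_open:
  "open S \<Longrightarrow> smooth_real_on S f \<Longrightarrow> (\<And>x. x \<in> S \<Longrightarrow> f x = g x) \<Longrightarrow> smooth_real_on S g"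
  unfolding smooth_real_on_def using C_on_cong_open[of S _ f g] by blast

lemma smooth_real_on_local:
  assumes "open S" "\<And>x. x \<in> S \<Longrightarrow> \<exists>U. open U \<and> x \<in> U \<and> smooth_real_on U f"
  shows "smooth_real_on S f"
  unfolding smooth_real_on_def
proof
  show "C_on k S f" for k
    using assms unfolding smooth_real_on_def by (intro C_on_local) blast+
qed

lemma smooth_real_on_const: "open S \<Longrightarrow> smooth_real_on S (\<lambda>_. c)"
  by (simp add: smooth_real_on_def C_on_const)

lemma smooth_real_on_bounded_linear: "open S \<Longrightarrow> bounded_linear f \<Longrightarrow> smooth_real_on S f"
  by (simp add: smooth_real_on_def C_on_bounded_linear)

lemma smooth_real_on_add:
  "open S \<Longrightarrow> smooth_real_on S f \<Longrightarrow> smooth_real_on S g \<Longrightarrow> smooth_real_on S (\<lambda>x. f x + g x)"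
  by (simp add: smooth_real_on_def C_on_add)

lemma smooth_real_on_mult:
  "open S \<Longrightarrow> smooth_real_on S f \<Longrightarrow> smooth_real_on S g \<Longrightarrow> smooth_real_on S (\<lambda>x. f x * g x)"
  by (simp add: smooth_real_on_def C_on_mult)

lemma smooth_real_on_sum:
  "open S \<Longrightarrow> (\<And>i. i \<in> I \<Longrightarrow> smooth_real_on S (f i)) \<Longrightarrow> smooth_real_on S (\<lambda>x. \<Sum>i\<in>I. f i x)"
  by (induction I rule: infinite_finite_induct) (auto intro: smooth_real_on_const smooth_real_on_add)

lemma smooth_real_on_compose_affine:
  "open S \<Longrightarrow> bounded_linear L \<Longrightarrow> smooth_real_on S f \<Longrightarrow>
    smooth_real_on ((\<lambda>x. L x + p) -` S) (\<lambda>x. f (L x + p))"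
  by (simp add: smooth_real_on_def C_on_compose_affine)

lemma smooth_real_on_compose_linear:
  "open S \<Longrightarrow> bounded_linear L \<Longrightarrow> smooth_real_on S f \<Longrightarrow> smooth_real_on (L -` S) (\<lambda>x. f (L x))"
  using smooth_real_on_compose_affine[of S L f 0] by simp

lemma smooth_real_on_subset: "smooth_real_on S f \<Longrightarrow> T \<subseteq> S \<Longrightarrow> smooth_real_on T f"
  by (auto simp: smooth_real_on_def intro: C_on_subset)

lemma smooth_real_on_has_derivative:
  "smooth_real_on S f \<Longrightarrow> x \<in> S \<Longrightarrow> (f has_derivative frechet_derivative f (at x)) (at x)"
  unfolding smooth_real_on_def using C_on_Suc_has_derivative by blast

lemma smooth_real_on_frechet_derivative:
  "smooth_real_on S f \<Longrightarrow> smooth_real_on S (\<lambda>x. frechet_derivative f (at x) v)"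
  unfolding smooth_real_on_def by (metis C_on.simps(2))

lemma smooth_real_on_imp_continuous_on: "smooth_real_on S f \<Longrightarrow> continuous_on S f"
  unfolding smooth_real_on_def by (metis C_on.simps(1))

text \<open>Used to bootstrap: a function that is only known to be differentiable is smooth once its derivative is
  given by a smooth formula.\<close>

lemma smooth_real_onI_derivative:
  assumes "open S" "\<And>x. x \<in> S \<Longrightarrow> (f has_derivative f' x) (at x)"
    and "\<And>v. smooth_real_on S (\<lambda>x. f' x v)"
  shows "smooth_real_on S f"
proof -
  have "C_on (Suc k) S f" for k
    using assms by (intro C_on_SucI) (auto simp: smooth_real_on_def)
  then show ?thesis
    unfolding smooth_real_on_def by (blast dest: C_on_Suc_lower)
qed

section \<open>Smooth maps into the circle and their real lifts\<close>

lemma mod_Z_eq_iff: "mod_Z x = mod_Z y \<longleftrightarrow> x - y \<in> \<int>"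
  by (rule u1.abs_eq_iff)

lemma mod_Z_surj: obtains t where "u = mod_Z t"
  by (induction u rule: u1.abs_induct) blast

lemma mod_Z_add: "mod_Z x + mod_Z y = mod_Z (x + y)"
  by (simp add: plus_u1.abs_eq)

lemma mod_Z_minus: "- mod_Z x = mod_Z (- x)"
  by (simp add: uminus_u1.abs_eq)

lemma mod_Z_eq_0_iff: "mod_Z x = 0 \<longleftrightarrow> x \<in> \<int>"
  by (simp add: zero_u1_def mod_Z_eq_iff)

lemma zscale_mod_Z: "k *\<^sub>Z mod_Z x = mod_Z (of_int k * x)"
  by (simp add: zscale.abs_eq)

lemma zscale_add_right: "k *\<^sub>Z (x + y) = k *\<^sub>Z x + k *\<^sub>Z y"
  by transfer (simp add: algebra_simps)

lemma zscale_zscale: "k *\<^sub>Z l *\<^sub>Z x = (k * l) *\<^sub>Z x"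
  by transfer (simp add: algebra_simps)

lemma zscale_zero_right [simp]: "k *\<^sub>Z 0 = 0"
  by transfer simp

lemma zscale_one [simp]: "1 *\<^sub>Z x = x"
  by transfer simp

lemma zscale_minus_one [simp]: "(-1) *\<^sub>Z x = - x"
  by transfer simp

lemma zscale_minus_right: "k *\<^sub>Z (- x) = - (k *\<^sub>Z x)"
  by transfer simp

lemma smooth_u1I: "smooth_real_on UNIV g \<Longrightarrow> smooth_u1 (\<lambda>x. mod_Z (g x))"
  unfolding smooth_u1_def by (metis UNIV_I open_UNIV)

lemma smooth_u1_zero: "smooth_u1 (\<lambda>_. 0)"
  using smooth_u1I[OF smooth_real_on_const[OF open_UNIV, of 0]] by (simp add: zero_u1_def)

lemma smooth_u1_add:
  assumes "smooth_u1 f" "smooth_u1 g"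
  shows "smooth_u1 (\<lambda>x. f x + g x)"
  unfolding smooth_u1_def
proof
  fix x
  obtain U p where U: "open U" "x \<in> U" "smooth_real_on U p" "\<forall>y\<in>U. f y = mod_Z (p y)"
    using assms(1) unfolding smooth_u1_def by metis
  obtain V q where V: "open V" "x \<in> V" "smooth_real_on V q" "\<forall>y\<in>V. g y = mod_Z (q y)"
    using assms(2) unfolding smooth_u1_def by metis
  have "smooth_real_on (U \<inter> V) (\<lambda>y. p y + q y)"
    using U V by (intro smooth_real_on_add) (auto intro: smooth_real_on_subset)
  with U V show "\<exists>U h. open U \<and> x \<in> U \<and> smooth_real_on U h \<and> (\<forall>y\<in>U. f y + g y = mod_Z (h y))"
    by (intro exI[of _ "U \<inter> V"] exI[of _ "\<lambda>y. p y + q y"]) (auto simp: mod_Z_add)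
qed

lemma smooth_u1_zscale:
  assumes "smooth_u1 f"
  shows "smooth_u1 (\<lambda>x. k *\<^sub>Z f x)"
  unfolding smooth_u1_def
proof
  fix x
  obtain U p where U: "open U" "x \<in> U" "smooth_real_on U p" "\<forall>y\<in>U. f y = mod_Z (p y)"
    using assms unfolding smooth_u1_def by metis
  have "smooth_real_on U (\<lambda>y. of_int k * p y)"
    using U by (intro smooth_real_on_mult smooth_real_on_const)
  with U show "\<exists>U h. open U \<and> x \<in> U \<and> smooth_real_on U h \<and> (\<forall>y\<in>U. k *\<^sub>Z f y = mod_Z (h y))"
    by (intro exI[of _ U] exI[of _ "\<lambda>y. of_int k * p y"]) (auto simp: zscale_mod_Z)
qed

lemma smooth_u1_minus: "smooth_u1 f \<Longrightarrow> smooth_u1 (\<lambda>x. - f x)"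
  using smooth_u1_zscale[of f "-1"] by simp

lemma smooth_u1_compose_linear:
  assumes "smooth_u1 f" "bounded_linear L"
  shows "smooth_u1 (\<lambda>x. f (L x))"
  unfolding smooth_u1_def
proof
  fix x
  obtain U p where U: "open U" "L x \<in> U" "smooth_real_on U p" "\<forall>y\<in>U. f y = mod_Z (p y)"
    using assms(1) unfolding smooth_u1_def by metis
  with assms(2) have "open (L -` U)" "smooth_real_on (L -` U) (\<lambda>y. p (L y))"
    by (auto intro: smooth_real_on_compose_linear simp: linear_continuous_on open_vimage)
  with U show "\<exists>U h. open U \<and> x \<in> U \<and> smooth_real_on U h \<and> (\<forall>y\<in>U. f (L y) = mod_Z (h y))"
    by (intro exI[of _ "L -` U"] exI[of _ "\<lambda>y. p (L y)"]) auto
qed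

text \<open>The principle by which identities modulo \<open>\<int>\<close> between circle-valued maps become identities between
  their real lifts, up to a constant.\<close>

lemma integer_valued_continuous_constant:
  fixes h :: "'a::topological_space \<Rightarrow> real"
  assumes "connected S" "continuous_on S h" "\<And>x. x \<in> S \<Longrightarrow> h x \<in> \<int>"
  shows "h constant_on S"
proof (rule continuous_discrete_range_constant[OF assms(1,2)])
  fix x assume "x \<in> S"
  have "1 \<le> norm (h y - h x)" if "y \<in> S" "h y \<noteq> h x" for y
    using Ints_nonzero_abs_ge1[OF Ints_diff[OF assms(3)[OF that(1)] assms(3)[OF \<open>x \<in> S\<close>]]] that(2)
    by simp
  then show "\<exists>e>0. \<forall>y. y \<in> S \<and> h y \<noteq> h x \<longrightarrow> e \<le> norm (h y - h x)"
    by (intro exI[of _ 1]) auto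
qed

text \<open>The embedding of the circle into the complex plane; it turns real lifts into logarithms.\<close>

definition circle_point :: "u1 \<Rightarrow> complex" where
  "circle_point u = exp (2 * pi * \<i> * rep_u1 u)"

lemma circle_point_mod_Z: "circle_point (mod_Z t) = exp (2 * pi * \<i> * t)"
proof -
  have "rep_u1 (mod_Z t) - t \<in> \<int>"
    using Quotient_rep_abs[OF Quotient_u1, of t] by (simp add: mod_Z_eq_iff)
  then obtain k where "rep_u1 (mod_Z t) = t + of_int k"
    by (metis Ints_cases add.commute diff_add_cancel)
  then have "2 * pi * \<i> * rep_u1 (mod_Z t) = 2 * pi * \<i> * t + (of_int (2 * k) * pi) * \<i>"
    by (simp add: algebra_simps)
  then show ?thesis
    unfolding circle_point_def exp_eq by blast
qed

text \<open>The vector space is contractible, so the nowhere vanishing complex function attached to \<open>f\<close> has a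
  continuous logarithm, whose imaginary part gives a continuous real lift. Near each point it differs
  from a smooth local lift by a continuous integer-valued function, that is, by a constant on a ball;
  hence it is itself smooth.\<close>

theorem smooth_u1_lift:
  fixes f :: "'a::euclidean_space \<Rightarrow> u1"
  assumes "smooth_u1 f"
  obtains g where "smooth_real_on UNIV g" "\<And>x. f x = mod_Z (g x)"
proof -
  have "continuous_on UNIV (\<lambda>x. circle_point (f x))"
  proof (rule continuous_at_imp_continuous_on, rule ballI)
    fix x
    obtain U p where U: "open U" "x \<in> U" "smooth_real_on U p" "\<forall>y\<in>U. f y = mod_Z (p y)"
      using assms unfolding smooth_u1_def by metis
    have "continuous_on U (\<lambda>y. exp (2 * pi * \<i> * p y))"
      using smooth_real_on_imp_continuous_on[OF U(3)] by (intro continuous_intros)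
    then have "continuous_on U (\<lambda>x. circle_point (f x))"
      by (rule continuous_on_eq) (simp add: U circle_point_mod_Z)
    then show "isCont (\<lambda>x. circle_point (f x)) x"
      using continuous_on_eq_continuous_at[OF U(1)] U(2) by blast
  qed
  moreover have "circle_point t \<noteq> 0" for t
    by (simp add: circle_point_def)
  ultimately obtain G where G: "continuous_on UNIV G" "\<And>x. circle_point (f x) = exp (G x)"
    using continuous_logarithm_on_contractible[OF _ contractible_UNIV] by (metis UNIV_I)
  define g where "g = (\<lambda>x. Im (G x) / (2 * pi))"
  have g_cont: "continuous_on UNIV g"
    unfolding g_def using G(1) by (intro continuous_intros) auto
  have lift: "f x = mod_Z (g x)" for x
  proof -
    obtain t where t: "f x = mod_Z t" by (rule mod_Z_surj)
    then have "exp (2 * pi * \<i> * t) = exp (G x)"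
      using G(2)[of x] by (simp add: circle_point_mod_Z)
    then obtain k :: int where "2 * pi * \<i> * t = G x + (of_int (2 * k) * pi) * \<i>"
      by (auto simp: exp_eq)
    then have "2 * pi * t = Im (G x) + 2 * k * pi"
      by (auto simp: complex_eq_iff)
    then have "t - g x = k" by (simp add: g_def field_simps)
    then show ?thesis by (simp add: t mod_Z_eq_iff)
  qed
  have "\<exists>U. open U \<and> x \<in> U \<and> smooth_real_on U g" for x
  proof -
    obtain U p where U: "open U" "x \<in> U" "smooth_real_on U p" "\<forall>y\<in>U. f y = mod_Z (p y)"
      using assms unfolding smooth_u1_def by metis
    obtain r where r: "r > 0" "ball x r \<subseteq> U" using U by (meson open_contains_ball)
    have "(\<lambda>y. g y - p y) constant_on ball x r"
    proof (rule integer_valued_continuous_constant)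
      show "continuous_on (ball x r) (\<lambda>y. g y - p y)"
        using g_cont smooth_real_on_imp_continuous_on[OF U(3)] r
        by (intro continuous_intros) (auto intro: continuous_on_subset)
      show "g y - p y \<in> \<int>" if "y \<in> ball x r" for y
      proof -
        have "mod_Z (g y) = mod_Z (p y)" using that r(2) U(4) lift[of y] by auto
        then show ?thesis by (simp only: mod_Z_eq_iff)
      qed
    qed auto
    then obtain k where k: "\<And>y. y \<in> ball x r \<Longrightarrow> g y - p y = k"
      unfolding constant_on_def by blast
    have "smooth_real_on (ball x r) (\<lambda>y. p y + k)"
      using U r by (intro smooth_real_on_add smooth_real_on_const) (auto intro: smooth_real_on_subset)
    then have "smooth_real_on (ball x r) g"
      by (rule smooth_real_on_cong_open[OF open_ball]) (simp add: k[symmetric])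
    then show ?thesis using r by (intro exI[of _ "ball x r"]) auto
  qed
  then have "smooth_real_on UNIV g"
    by (intro smooth_real_on_local[OF open_UNIV])
  with lift show ?thesis by (rule that[rotated])
qed

section \<open>Smooth cocycles with real values\<close>

text \<open>An additive function has the same derivative \<open>D\<close> at every point, so \<open>g - D\<close> has derivative zero.\<close>

lemma smooth_additive_imp_bounded_linear:
  fixes g :: "'a::euclidean_space \<Rightarrow> real"
  assumes smooth: "smooth_real_on UNIV g" and add: "\<And>x y. g (x + y) = g x + g y"
  shows "bounded_linear g"
proof -
  define D where "D = frechet_derivative g (at 0)"
  have D0: "(g has_derivative D) (at 0)"
    unfolding D_def by (rule smooth_real_on_has_derivative[OF smooth UNIV_I])
  then have lin: "bounded_linear D" by (rule has_derivative_bounded_linear)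
  have "((\<lambda>y. g y - D y) has_derivative (\<lambda>_. 0)) (at x)" for x
  proof -
    have "((\<lambda>y. y - x) has_derivative (\<lambda>v. v)) (at x)"
      by (auto intro!: derivative_eq_intros)
    then have "((\<lambda>y. g (y - x)) has_derivative D) (at x)"
      using has_derivative_compose[of "\<lambda>y. y - x" "\<lambda>v. v" x UNIV g D] D0 by simp
    then have "((\<lambda>y. g (y - x) + g x - D y) has_derivative (\<lambda>v. D v + 0 - D v)) (at x)"
      by (intro has_derivative_add has_derivative_diff has_derivative_const
          bounded_linear_imp_has_derivative lin)
    then show ?thesis by (simp add: add[symmetric])
  qed
  then have "g x - D x = g 0 - D 0" for x
    using has_derivative_zero_unique[of UNIV "\<lambda>y. g y - D y" x 0] by simp
  moreover have "g 0 = 0" using add[of 0 0] by simp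
  moreover have "D 0 = 0" using lin by (simp add: linear_simps)
  ultimately have "g = D" by (auto simp: fun_eq_iff)
  with lin show ?thesis by simp
qed

text \<open>The vanishing of the symmetric part of the second smooth cohomology of a vector space. Let \<open>\<theta>\<close> be the
  one-form whose value at \<open>x\<close> is the derivative of \<open>c (x, \<cdot>)\<close> at \<open>0\<close>. Differentiating the cocycle identity
  in its third argument expresses the second partial derivative of \<open>c\<close> through \<open>\<theta>\<close>; by symmetry so is the
  first one, and \<open>c\<close> has the derivative that \<open>B (x + y) - B x - B y\<close> would have if \<open>\<theta>\<close> were the
  derivative of \<open>B\<close>. It suffices to integrate \<open>\<theta>\<close> along the rays from the origin: along the ray through
  \<open>(x, y)\<close> both sides then have the same derivative. No regularity of such a \<open>B\<close> comes for free, but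
  the coboundary equation itself transports differentiability from the origin to every other point.\<close>

lemma smooth_symmetric_cocycle_is_coboundary:
  fixes c :: "'a::euclidean_space \<times> 'a \<Rightarrow> real"
  assumes smooth: "smooth_real_on UNIV c"
    and cocycle: "\<And>x y z. c (x, y) + c (x + y, z) = c (y, z) + c (x, y + z)"
    and sym: "\<And>x y. c (x, y) = c (y, x)"
  obtains B where "smooth_real_on UNIV B" "\<And>x y. c (x, y) = B (x + y) - B x - B y"
proof -
  define C where "C p = frechet_derivative c (at p)" for p
  have C: "(c has_derivative C p) (at p)" for p
    unfolding C_def by (rule smooth_real_on_has_derivative[OF smooth UNIV_I])
  have C_lin: "bounded_linear (C p)" for p
    by (rule has_derivative_bounded_linear[OF C])
  define \<theta> where "\<theta> x v = C (x, 0) (0, v)" for x v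
  have \<theta>_smooth: "smooth_real_on UNIV (\<lambda>x. \<theta> x v)" for v
  proof -
    have "bounded_linear (\<lambda>x::'a. (x, 0::'a))"
      by (intro bounded_linear_Pair bounded_linear_ident bounded_linear_zero)
    from smooth_real_on_compose_linear[OF open_UNIV this smooth_real_on_frechet_derivative[OF smooth, of "(0, v)"]]
    show ?thesis by (simp add: \<theta>_def C_def)
  qed
  have \<theta>_lin: "bounded_linear (\<theta> x)" for x
    unfolding \<theta>_def
    by (rule bounded_linear_compose[OF C_lin])
      (intro bounded_linear_Pair bounded_linear_ident bounded_linear_zero)
  have partial2: "((\<lambda>z. c (x, y + z)) has_derivative (\<lambda>v. C (x, y) (0, v))) (at 0)" for x y
  proof -
    have "((\<lambda>z. (x, y + z)) has_derivative (\<lambda>v. (0, v))) (at 0)"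
      by (auto intro!: derivative_eq_intros)
    then show ?thesis
      using has_derivative_compose[of "\<lambda>z. (x, y + z)" "\<lambda>v. (0, v)" 0 UNIV c] C by simp
  qed
  \<comment> \<open>the derivative at \<open>z = 0\<close> of both sides of the cocycle identity\<close>
  have C_second: "C (x, y) (0, v) = \<theta> (x + y) v - \<theta> y v" for x y v
  proof -
    have p0: "((\<lambda>z. c (x, z)) has_derivative \<theta> x) (at 0)" for x
      using partial2[of x 0] by (simp add: \<theta>_def[abs_def])
    have "((\<lambda>z. c (y, z) + c (x, y + z)) has_derivative (\<lambda>v. \<theta> y v + C (x, y) (0, v))) (at 0)"
      by (intro has_derivative_add p0 partial2)
    moreover have "((\<lambda>z. c (x, y) + c (x + y, z)) has_derivative (\<lambda>v. 0 + \<theta> (x + y) v)) (at 0)"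
      by (intro has_derivative_add p0 has_derivative_const)
    ultimately have "(\<lambda>v. \<theta> y v + C (x, y) (0, v)) = (\<lambda>v. 0 + \<theta> (x + y) v)"
      unfolding cocycle by (rule has_derivative_unique)
    then have "\<theta> y v + C (x, y) (0, v) = 0 + \<theta> (x + y) v" by (rule fun_cong)
    then show ?thesis by simp
  qed
  have C_swap: "C (x, y) (v, w) = C (y, x) (w, v)" for x y v w
  proof -
    have "((\<lambda>p. (snd p, fst p)) has_derivative (\<lambda>q. (snd q, fst q))) (at (x, y))"
      by (auto intro!: derivative_eq_intros)
    then have "((\<lambda>p. c (snd p, fst p)) has_derivative (\<lambda>q. C (y, x) (snd q, fst q))) (at (x, y))"
      using has_derivative_compose[of "\<lambda>p. (snd p, fst p)" "\<lambda>q. (snd q, fst q)" "(x, y)" UNIV c] C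
      by simp
    moreover have "(\<lambda>p. c (snd p, fst p)) = c"
      by (rule ext) (metis sym prod.collapse)
    ultimately have "C (x, y) = (\<lambda>q. C (y, x) (snd q, fst q))"
      using has_derivative_unique[OF C] by metis
    then show ?thesis by simp
  qed
  have C_formula: "C (x, y) (v, w) = \<theta> (x + y) (v + w) - \<theta> x v - \<theta> y w" for x y v w
  proof -
    have "C (x, y) (v, w) = C (x, y) ((v, 0) + (0, w))" by simp
    also have "\<dots> = C (x, y) (v, 0) + C (x, y) (0, w)"
      by (rule linear_add[OF bounded_linear.linear[OF C_lin]])
    also have "\<dots> = \<theta> (x + y) v - \<theta> x v + (\<theta> (x + y) w - \<theta> y w)"
      unfolding C_swap[of x y v 0] C_second by (simp add: add.commute)
    finally show ?thesis
      by (simp add: linear_add[OF bounded_linear.linear[OF \<theta>_lin]])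
  qed
  \<comment> \<open>an antiderivative of \<open>\<theta>\<close> along the segment from \<open>0\<close> to \<open>x\<close>, for each \<open>x\<close>\<close>
  have "\<forall>x. \<exists>F. F 0 = 0 \<and> (\<forall>s\<in>{0..1}. (F has_vector_derivative \<theta> (s *\<^sub>R x) x) (at s within {0..1}))"
  proof
    fix x
    have "continuous_on {0..1} (\<lambda>s::real. \<theta> (s *\<^sub>R x) x)"
      by (rule continuous_on_compose2[OF smooth_real_on_imp_continuous_on[OF \<theta>_smooth]])
        (auto intro!: continuous_intros)
    then obtain F where F: "\<And>s. s \<in> {0..1} \<Longrightarrow> (F has_vector_derivative \<theta> (s *\<^sub>R x) x) (at s within {0..1})"
      by (rule antiderivative_continuous) blast
    have "((\<lambda>s. F s - F 0) has_vector_derivative \<theta> (s *\<^sub>R x) x) (at s within {0..1})" if "s \<in> {0..1}" for s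
      using has_vector_derivative_diff_const[of F "F 0"] F[OF that] by simp
    then show "\<exists>F. F 0 = 0 \<and> (\<forall>s\<in>{0..1}. (F has_vector_derivative \<theta> (s *\<^sub>R x) x) (at s within {0..1}))"
      by (intro exI[of _ "\<lambda>s. F s - F 0"]) simp
  qed
  from choice[OF this] obtain F where F0: "\<And>x. F x 0 = 0"
    and F: "\<And>x s. s \<in> {0..1} \<Longrightarrow> (F x has_vector_derivative \<theta> (s *\<^sub>R x) x) (at s within {0..1})"
    by blast
  have F_real: "(F x has_derivative (\<lambda>h. h * \<theta> (s *\<^sub>R x) x)) (at s within {0..1})" if "s \<in> {0..1}" for x s
    using F[OF that, of x] by (simp add: has_vector_derivative_def)
  \<comment> \<open>the constant accounts for \<open>B (0 + 0) - B 0 - B 0 = - B 0\<close>\<close>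
  define B where "B x = F x 1 - c (0, 0)" for x
  have cob: "c (x, y) = B (x + y) - B x - B y" for x y
  proof -
    define f where "f s = F (x + y) s - F x s - F y s - c (s *\<^sub>R x, s *\<^sub>R y)" for s
    have "(f has_derivative (\<lambda>h. 0)) (at s within {0..1})" if s: "s \<in> {0..1}" for s
    proof -
      have "((\<lambda>s. (s *\<^sub>R x, s *\<^sub>R y)) has_derivative (\<lambda>h. (h *\<^sub>R x, h *\<^sub>R y))) (at s within {0..1})"
        by (auto intro!: derivative_eq_intros)
      then have dc: "((\<lambda>s. c (s *\<^sub>R x, s *\<^sub>R y)) has_derivative (\<lambda>h. C (s *\<^sub>R x, s *\<^sub>R y) (h *\<^sub>R x, h *\<^sub>R y)))
          (at s within {0..1})"
        by (rule has_derivative_compose[OF _ C])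
      have "(f has_derivative (\<lambda>h. h * \<theta> (s *\<^sub>R (x + y)) (x + y) - h * \<theta> (s *\<^sub>R x) x - h * \<theta> (s *\<^sub>R y) y
           - C (s *\<^sub>R x, s *\<^sub>R y) (h *\<^sub>R x, h *\<^sub>R y))) (at s within {0..1})"
        unfolding f_def by (intro has_derivative_diff F_real s dc)
      moreover have "h * \<theta> (s *\<^sub>R (x + y)) (x + y) - h * \<theta> (s *\<^sub>R x) x - h * \<theta> (s *\<^sub>R y) y
           - C (s *\<^sub>R x, s *\<^sub>R y) (h *\<^sub>R x, h *\<^sub>R y) = 0" for h
        unfolding C_formula
        by (simp add: linear_scale[OF bounded_linear.linear[OF \<theta>_lin]] flip: scaleR_add_right)
      ultimately show ?thesis by simp
    qed
    then have "f 1 = f 0"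
      using has_derivative_zero_unique[of "{0..1}" f 1 0] by simp
    then show ?thesis
      by (simp add: f_def F0 B_def)
  qed
  \<comment> \<open>by the mean value theorem the increment of \<open>B\<close> is \<open>\<theta>\<close> at an intermediate point, which is close to \<open>\<theta> 0\<close>\<close>
  have B0: "(B has_derivative \<theta> 0) (at 0)"
    unfolding has_derivative_at_alt
  proof (intro conjI allI impI \<theta>_lin)
    fix e :: real assume e: "e > 0"
    define e' where "e' = e / DIM('a)"
    have "e' > 0" using e by (simp add: e'_def)
    have "\<forall>\<^sub>F z in nhds 0. \<bar>\<theta> z b - \<theta> 0 b\<bar> < e'" for b
    proof -
      have "isCont (\<lambda>x. \<theta> x b) 0"
        using smooth_real_on_imp_continuous_on[OF \<theta>_smooth] by (simp add: continuous_on_eq_continuous_at)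
      then have "((\<lambda>x. \<theta> x b) \<longlongrightarrow> \<theta> 0 b) (nhds 0)"
        using tendsto_at_iff_tendsto_nhds[of "\<lambda>x. \<theta> x b" 0] unfolding isCont_def by blast
      from tendstoD[OF this \<open>e' > 0\<close>] show ?thesis by (simp add: dist_real_def)
    qed
    then have "\<forall>\<^sub>F z in nhds 0. \<forall>b\<in>Basis. \<bar>\<theta> z b - \<theta> 0 b\<bar> < e'"
      by (simp add: eventually_ball_finite)
    then obtain d where d: "d > 0" "\<And>z b. norm z < d \<Longrightarrow> b \<in> Basis \<Longrightarrow> \<bar>\<theta> z b - \<theta> 0 b\<bar> < e'"
      unfolding eventually_nhds_metric by (auto simp: dist_norm)
    have "norm (B y - B 0 - \<theta> 0 (y - 0)) \<le> e * norm (y - 0)" if y: "norm (y - 0) < d" for y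
    proof -
      obtain s where s: "s \<in> {0<..<1}" "F y 1 - F y 0 = (1 - 0) * \<theta> (s *\<^sub>R y) y"
        using mvt_simple[of 0 1 "F y" "\<lambda>s h. h * \<theta> (s *\<^sub>R y) y"] F_real[of _ y] by auto
      have "norm (s *\<^sub>R y) \<le> norm y"
        using s(1) by (auto simp: mult_left_le_one_le)
      then have sy: "norm (s *\<^sub>R y) < d" using y by simp
      have exp: "\<theta> z y = (\<Sum>b\<in>Basis. (y \<bullet> b) * \<theta> z b)" for z
      proof -
        have "\<theta> z y = \<theta> z (\<Sum>b\<in>Basis. (y \<bullet> b) *\<^sub>R b)" by (simp add: euclidean_representation)
        also have "\<dots> = (\<Sum>b\<in>Basis. (y \<bullet> b) * \<theta> z b)"
          by (simp only: linear_sum[OF bounded_linear.linear[OF \<theta>_lin]]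
              linear_scale[OF bounded_linear.linear[OF \<theta>_lin]] real_scaleR_def)
        finally show ?thesis .
      qed
      have F01: "F 0 1 = 0"
      proof -
        obtain s where "F 0 1 - F 0 0 = (1 - 0) * \<theta> (s *\<^sub>R 0) 0"
          using mvt_simple[of 0 1 "F 0" "\<lambda>s h. h * \<theta> (s *\<^sub>R 0) 0"] F_real[of _ 0] by auto
        then show ?thesis using F0 by (simp add: linear_0[OF bounded_linear.linear[OF \<theta>_lin]])
      qed
      have "B y - B 0 - \<theta> 0 (y - 0) = \<theta> (s *\<^sub>R y) y - \<theta> 0 y"
        using s(2) by (simp add: B_def F0 F01)
      also have "\<dots> = (\<Sum>b\<in>Basis. (y \<bullet> b) * (\<theta> (s *\<^sub>R y) b - \<theta> 0 b))"
        unfolding exp[of "s *\<^sub>R y"] exp[of 0] by (simp add: right_diff_distrib sum_subtractf)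
      finally have "norm (B y - B 0 - \<theta> 0 (y - 0)) \<le> (\<Sum>b\<in>Basis. norm ((y \<bullet> b) * (\<theta> (s *\<^sub>R y) b - \<theta> 0 b)))"
        by (simp only: norm_sum)
      also have "\<dots> \<le> (\<Sum>b\<in>(Basis::'a set). norm y * e')"
        unfolding norm_mult
        using d(2)[OF sy] by (intro sum_mono mult_mono) (auto simp: Basis_le_norm less_imp_le)
      also have "\<dots> = e * norm (y - 0)" by (simp add: e'_def)
      finally show ?thesis .
    qed
    with d(1) show "\<exists>d>0. \<forall>y. norm (y - 0) < d \<longrightarrow> norm (B y - B 0 - \<theta> 0 (y - 0)) \<le> e * norm (y - 0)"
      by blast
  qed
  \<comment> \<open>differentiate \<open>B y = B x + B (y - x) + c (x, y - x)\<close> at \<open>y = x\<close>\<close>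
  have B_deriv: "(B has_derivative (\<lambda>v. \<theta> 0 v + \<theta> x v)) (at x)" for x
  proof -
    have sh: "((\<lambda>y. y - x) has_derivative (\<lambda>v. v)) (at x)"
      by (auto intro!: derivative_eq_intros)
    have 1: "((\<lambda>y. B (y - x)) has_derivative \<theta> 0) (at x)"
      using has_derivative_compose[OF sh, of B "\<theta> 0"] B0 by simp
    have "((\<lambda>z. c (x, z)) has_derivative \<theta> x) (at (x - x))"
      using partial2[of x 0] by (simp add: \<theta>_def[abs_def])
    then have 2: "((\<lambda>y. c (x, y - x)) has_derivative \<theta> x) (at x)"
      using has_derivative_compose[OF sh, of "\<lambda>z. c (x, z)" "\<theta> x"] by simp
    have "((\<lambda>y. B x + (B (y - x) + c (x, y - x))) has_derivative (\<lambda>v. 0 + (\<theta> 0 v + \<theta> x v))) (at x)"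
      by (intro has_derivative_add has_derivative_const 1 2)
    moreover have "B x + (B (y - x) + c (x, y - x)) = B y" for y
      using cob[of x "y - x"] by simp
    ultimately show ?thesis by simp
  qed
  have "smooth_real_on UNIV B"
    by (rule smooth_real_onI_derivative[OF open_UNIV B_deriv])
      (intro smooth_real_on_add smooth_real_on_const open_UNIV \<theta>_smooth)
  then show ?thesis using cob by (rule that)
qed

section \<open>Smooth cocycles with values in the circle\<close>

lemma real_vec_add: "real_vec (m + m') = real_vec m + real_vec m'"
  by (simp add: real_vec_def vec_eq_iff)

lemma real_vec_zero: "real_vec 0 = 0"
  by (simp add: real_vec_def vec_eq_iff)

lemma real_vec_axis: "real_vec (axis i k) = axis i (of_int k)"
  by (simp add: real_vec_def vec_eq_iff axis_def)

lemma additive_int_vec_eq_0: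
  fixes h :: "int ^ 'k::finite \<Rightarrow> 'b::ab_group_add"
  assumes add: "\<And>m m'. h (m + m') = h m + h m'" and basis: "\<And>i. h (axis i 1) = 0"
  shows "h m = 0"
proof -
  have h0: "h 0 = 0" using add[of 0 0] by simp
  have axis_add: "axis i (k + l) = axis i k + axis i l" for i :: 'k and k l :: int
    by (simp add: axis_def vec_eq_iff)
  have axis: "h (axis i k) = 0" for i k
  proof (induction k rule: int_induct[where k = "0::int"])
    case base
    have "axis i (0::int) = 0" by (simp add: axis_def vec_eq_iff)
    then show ?case using h0 by (simp only:)
  next
    case (step1 k)
    then show ?case by (simp add: axis_add add basis)
  next
    case (step2 k)
    have "h (axis i k) = h (axis i (k - 1)) + h (axis i 1)"
      by (simp add: add[symmetric] axis_add[symmetric])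
    then show ?case using step2 basis by simp
  qed
  have "h (\<Sum>i\<in>I. axis i (m $ i)) = 0" if "finite I" for I
    using that by induction (simp_all add: h0 add axis)
  moreover have "(\<Sum>i\<in>UNIV. axis i (m $ i)) = m"
    by (simp add: vec_eq_iff axis_def)
  ultimately show ?thesis by (metis finite)
qed

text \<open>Add the cocycle identities for \<open>(x, y, z)\<close> and \<open>(z, x, y)\<close> and subtract the one for \<open>(x, z, y)\<close>.\<close>

lemma cocycle_antisymmetrization_additive:
  fixes c :: "'a::ab_group_add \<times> 'a \<Rightarrow> real"
  assumes cocycle: "\<And>x y z. c (x, y) + c (x + y, z) = c (y, z) + c (x, y + z)"
  shows "c (x + y, z) - c (z, x + y) = (c (x, z) - c (z, x)) + (c (y, z) - c (z, y))"
  using cocycle[of x y z] cocycle[of z x y] cocycle[of x z y]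
  by (simp add: add.commute)

text \<open>The antisymmetrization of \<open>c\<close> is biadditive. For a lattice vector in the first slot it is a continuous
  integer-valued function of the other slot, hence constant, hence zero; being additive and smooth, thus
  linear, in the first slot, it vanishes altogether, because the lattice spans.\<close>

lemma cocycle_symmetric_if_integral:
  fixes c :: "'n::finite rvec \<times> 'n rvec \<Rightarrow> real"
  assumes smooth: "smooth_real_on UNIV c"
    and cocycle: "\<And>x y z. c (x, y) + c (x + y, z) = c (y, z) + c (x, y + z)"
    and integral: "\<And>m a. c (real_vec m, a) - c (a, real_vec m) \<in> \<int>"
  shows "c (x, y) = c (y, x)"
proof -
  define w where "w x y = c (x, y) - c (y, x)" for x y
  have w_add: "w (x + y) z = w x z + w y z" for x y z
    unfolding w_def by (rule cocycle_antisymmetrization_additive[OF cocycle])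
  have w_smooth: "smooth_real_on UNIV (\<lambda>x. w x a)" for a
  proof -
    have L: "bounded_linear (\<lambda>x::'n rvec. (x, 0::'n rvec))" "bounded_linear (\<lambda>x::'n rvec. (0::'n rvec, x))"
      by (intro bounded_linear_Pair bounded_linear_ident bounded_linear_zero)+
    have "smooth_real_on UNIV (\<lambda>x. c (x, a))" "smooth_real_on UNIV (\<lambda>x. c (a, x))"
      using smooth_real_on_compose_affine[OF open_UNIV L(1) smooth, of "(0, a)"]
        smooth_real_on_compose_affine[OF open_UNIV L(2) smooth, of "(a, 0)"] by simp_all
    then have "smooth_real_on UNIV (\<lambda>x. c (x, a) + (-1) * c (a, x))"
      by (intro smooth_real_on_add smooth_real_on_mult smooth_real_on_const open_UNIV)
    then show ?thesis by (simp add: w_def)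
  qed
  have w_swap: "w x y = - w y x" for x y by (simp add: w_def)
  have w_0: "w x 0 = 0" for x
    using w_add[of 0 0 x] w_swap[of x 0] by simp
  have lattice: "w (real_vec m) a = 0" for m a
  proof -
    have "continuous_on UNIV (w (real_vec m))"
      using smooth_real_on_imp_continuous_on[OF w_smooth[of "real_vec m"]]
      by (subst w_swap[abs_def]) (intro continuous_intros)
    then have "w (real_vec m) constant_on UNIV"
      by (rule integer_valued_continuous_constant[OF connected_UNIV])
        (simp add: w_def integral)
    then have "w (real_vec m) a = w (real_vec m) 0"
      unfolding constant_on_def by (metis UNIV_I)
    then show ?thesis by (simp add: w_0)
  qed
  have "w x a = 0" for x a
  proof -
    have "bounded_linear (\<lambda>x. w x a)"
      by (rule smooth_additive_imp_bounded_linear[OF w_smooth w_add])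
    then have "linear (\<lambda>x. w x a)" by (rule bounded_linear.linear)
    then show ?thesis
      by (rule linear_eq_0_on_span[where b = Basis, simplified])
        (use lattice[of "axis _ 1"] in \<open>auto simp: Basis_vec_def real_vec_axis\<close>)
  qed
  then show ?thesis by (simp add: w_def)
qed

text \<open>Any two objects over the same matrix differ by a cocycle \<open>d\<close> as here, so this is the statement that they
  are isomorphic. Lift \<open>d\<close> to a real function \<open>c\<close>, which is again a cocycle, symmetric by the previous
  lemma, and therefore the coboundary of some \<open>B\<close>. Modulo \<open>\<int>\<close> the function \<open>B\<close> is additive on the
  lattice, where \<open>d\<close> vanishes; subtracting the linear function with the same values on the standard basis
  makes it zero there and does not affect the coboundary.\<close>

theorem lattice_trivial_cocycle_is_coboundary:
  fixes d :: "'n::finite rvec \<times> 'n rvec \<Rightarrow> u1"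
  assumes smooth: "smooth_u1 d"
    and cocycle: "\<And>x y z. d (x, y) + d (x + y, z) = d (y, z) + d (x, y + z)"
    and lattice: "\<And>m m'. d (real_vec m, real_vec m') = 0"
    and sym: "\<And>m a. d (real_vec m, a) = d (a, real_vec m)"
  obtains \<beta> where "smooth_u1 \<beta>" "\<And>m. \<beta> (real_vec m) = 0"
    "\<And>x y. \<beta> x + \<beta> y = d (x, y) + \<beta> (x + y)"
proof -
  obtain c where c: "smooth_real_on UNIV c" "\<And>p. d p = mod_Z (c p)"
    using smooth_u1_lift[OF smooth] by blast
  have c_cocycle: "c (x, y) + c (x + y, z) = c (y, z) + c (x, y + z)" for x y z
  proof -
    define K where "K = (\<lambda>(x, y, z). c (x, y) + c (x + y, z) - (c (y, z) + c (x, y + z)))"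
    have cc: "continuous_on UNIV (\<lambda>p. c (f p))" if "continuous_on UNIV f" for f :: "'n rvec \<times> 'n rvec \<times> 'n rvec \<Rightarrow> _"
      by (rule continuous_on_compose2[OF smooth_real_on_imp_continuous_on[OF c(1)] that]) simp
    have "continuous_on UNIV K"
      unfolding K_def case_prod_beta by (intro continuous_intros cc)
    \<comment> \<open>an integer constant, whose value is read off at the origin, where the four terms cancel\<close>
    moreover have "K p \<in> \<int>" for p
      using cocycle[of "fst p" "fst (snd p)" "snd (snd p)"]
      unfolding c(2) mod_Z_add mod_Z_eq_iff by (simp add: K_def case_prod_beta)
    ultimately have "K constant_on UNIV"
      by (intro integer_valued_continuous_constant connected_UNIV)
    then have "K (x, y, z) = K (0, 0, 0)"
      unfolding constant_on_def by (metis UNIV_I)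
    then show ?thesis by (simp add: K_def)
  qed
  have c_sym: "c (x, y) = c (y, x)" for x y
  proof (rule cocycle_symmetric_if_integral[OF c(1) c_cocycle])
    show "c (real_vec m, a) - c (a, real_vec m) \<in> \<int>" for m a
      using sym[of m a] unfolding c(2) mod_Z_eq_iff .
  qed
  obtain B where B: "smooth_real_on UNIV B" "\<And>x y. c (x, y) = B (x + y) - B x - B y"
    using smooth_symmetric_cocycle_is_coboundary[OF c(1) c_cocycle c_sym] by blast
  define l where "l x = (\<Sum>i\<in>UNIV. x $ i * B (axis i 1))" for x :: "'n rvec"
  have l_add: "l (x + y) = l x + l y" for x y
    by (simp add: l_def sum.distrib distrib_right)
  have l_axis: "l (axis i 1) = B (axis i 1)" for i
    by (simp add: l_def axis_def if_distrib[of "\<lambda>t. t * B u" for u] cong: if_cong)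
  define \<beta> where "\<beta> x = mod_Z (l x - B x)" for x
  have coboundary: "\<beta> x + \<beta> y = d (x, y) + \<beta> (x + y)" for x y
    by (simp add: \<beta>_def c(2) B(2) mod_Z_add l_add algebra_simps)
  show ?thesis
  proof (rule that)
    have "smooth_real_on UNIV (\<lambda>x. l x + (-1) * B x)"
      unfolding l_def
      by (intro smooth_real_on_add smooth_real_on_mult smooth_real_on_sum smooth_real_on_const
          smooth_real_on_bounded_linear bounded_linear_vec_nth B(1) open_UNIV)
    then show "smooth_u1 \<beta>"
      unfolding \<beta>_def[abs_def] by (intro smooth_u1I) simp
    show "\<beta> (real_vec m) = 0" for m
    proof (rule additive_int_vec_eq_0[where h = "\<lambda>m. \<beta> (real_vec m)"])
      show "\<beta> (real_vec (m + m')) = \<beta> (real_vec m) + \<beta> (real_vec m')" for m m'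
        using coboundary[of "real_vec m" "real_vec m'"] by (simp add: lattice real_vec_add)
      show "\<beta> (real_vec (axis i 1)) = 0" for i
        by (simp add: \<beta>_def real_vec_axis l_axis mod_Z_eq_0_iff)
    qed
  qed (rule coboundary)
qed

text \<open>The characters of the torus: a real lift, normalised to vanish at \<open>0\<close>, is additive and smooth, hence
  linear, and its values on the standard basis are integers because \<open>\<beta>\<close> is trivial on the lattice.\<close>

theorem smooth_u1_hom_vanishing_on_lattice:
  fixes \<beta> :: "'n::finite rvec \<Rightarrow> u1"
  assumes smooth: "smooth_u1 \<beta>" and add: "\<And>x y. \<beta> (x + y) = \<beta> x + \<beta> y"
    and lattice: "\<And>m. \<beta> (real_vec m) = 0"
  obtains m where "\<And>x. \<beta> x = mod_Z (real_vec m \<bullet> x)"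
proof -
  obtain g where g: "smooth_real_on UNIV g" "\<And>x. \<beta> x = mod_Z (g x)"
    using smooth_u1_lift[OF smooth] by blast
  have g0: "g 0 \<in> \<int>"
    using lattice[of 0] by (simp add: real_vec_zero g(2) mod_Z_eq_0_iff)
  define f where "f x = g x + (- g 0)" for x
  have f: "smooth_real_on UNIV f"
    unfolding f_def by (intro smooth_real_on_add smooth_real_on_const g(1) open_UNIV)
  have \<beta>_f: "\<beta> x = mod_Z (f x)" for x
    by (simp add: g(2) mod_Z_eq_iff f_def g0)
  have "f (x + y) = f x + f y" for x y
  proof -
    define K where "K = (\<lambda>(x, y). f (x + y) - (f x + f y))"
    have cc: "continuous_on UNIV (\<lambda>p. f (h p))" if "continuous_on UNIV h" for h :: "'n rvec \<times> 'n rvec \<Rightarrow> _"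
      by (rule continuous_on_compose2[OF smooth_real_on_imp_continuous_on[OF f] that]) simp
    have "continuous_on UNIV K"
      unfolding K_def case_prod_beta by (intro continuous_intros cc)
    moreover have "K p \<in> \<int>" for p
      using add[of "fst p" "snd p"]
      unfolding \<beta>_f mod_Z_add mod_Z_eq_iff by (simp add: K_def case_prod_beta)
    ultimately have "K constant_on UNIV"
      by (intro integer_valued_continuous_constant connected_UNIV)
    then have "K (x, y) = K (0, 0)"
      unfolding constant_on_def by (metis UNIV_I)
    then show ?thesis by (simp add: K_def f_def)
  qed
  then have "bounded_linear f"
    by (rule smooth_additive_imp_bounded_linear[OF f])
  then have lin: "linear f" by (rule bounded_linear.linear)
  define m where "m = (\<chi> i. \<lfloor>f (axis i 1)\<rfloor>)"
  have m: "real_vec m $ i = f (axis i 1)" for i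
  proof -
    have "f (axis i 1) \<in> \<int>"
      using lattice[of "axis i 1"] by (simp add: real_vec_axis \<beta>_f mod_Z_eq_0_iff)
    then show ?thesis by (simp add: m_def real_vec_def)
  qed
  have "f x = real_vec m \<bullet> x" for x
  proof -
    have "f x = f (\<Sum>i\<in>UNIV. x $ i *\<^sub>R axis i 1)"
      by (simp only: basis_expansion scalar_mult_eq_scaleR[symmetric])
    also have "\<dots> = (\<Sum>i\<in>UNIV. x $ i * f (axis i 1))"
      by (simp only: linear_sum[OF lin] linear_scale[OF lin] real_scaleR_def)
    finally show ?thesis by (simp add: inner_vec_def m mult.commute)
  qed
  then have "\<beta> x = mod_Z (real_vec m \<bullet> x)" for x by (simp add: \<beta>_f)
  then show ?thesis by (rule that)
qed

section \<open>The integral orthogonal group up to sign\<close>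

lemma real_mat_mult: "real_mat (A ** B) = real_mat A ** real_mat B"
  by (simp add: real_mat_def matrix_matrix_mult_def vec_eq_iff)

lemma real_mat_one: "real_mat (mat 1) = mat 1"
  by (simp add: real_mat_def mat_def vec_eq_iff)

lemma real_mat_transpose: "real_mat (transpose A) = transpose (real_mat A)"
  by (simp add: real_mat_def transpose_def vec_eq_iff)

lemma real_mat_times_real_vec: "real_mat A *v real_vec m = real_vec (A *v m)"
  by (simp add: real_mat_def real_vec_def matrix_vector_mult_def vec_eq_iff)

lemma real_mat_mat: "real_mat (mat k) *v a = of_int k *\<^sub>R a"
  by (simp add: real_mat_def mat_def matrix_vector_mult_def vec_eq_iff if_distrib[of "\<lambda>t. t * a $ i" for i]
      if_distrib[of of_int] cong: if_cong)

lemma bounded_linear_real_mat: "bounded_linear (\<lambda>a. real_mat A *v a)"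
  by simp

lemma mat_mult_nth: "(mat k ** M) $ i $ j = k * M $ i $ j" for M :: "int ^ 'k::finite ^ 'k"
  by (simp add: matrix_matrix_mult_def mat_def if_distrib[of "\<lambda>t. t * M $ i $ j" for i j] cong: if_cong)

lemma mult_mat_nth: "(M ** mat k) $ i $ j = M $ i $ j * k" for M :: "int ^ 'k::finite ^ 'k"
  by (simp add: matrix_matrix_mult_def mat_def if_distrib[of "\<lambda>t. M $ i $ j * t" for i j] cong: if_cong)

text \<open>Signs are written as scalar matrices, so that both cases of the condition \<open>A\<^sup>t I A = \<plusminus>I\<close> can be
  treated as one matrix identity.\<close>

lemma mat_commute: "M ** mat k = mat k ** M" for M :: "int ^ 'k::finite ^ 'k"
  by (simp add: vec_eq_iff mat_mult_nth mult_mat_nth mult.commute)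

lemma mat_mult_mat: "mat k ** mat l = (mat (k * l) :: int ^ 'k::finite ^ 'k)"
  by (simp add: vec_eq_iff mat_mult_nth) (simp add: mat_def)

lemma I_mat_nth: "I_mat $ i $ j = (if j = case_sum Inr Inl i then 1 else 0)"
  by (auto simp: I_mat_def block_matrix_def mat_def split: sum.splits)

lemma I_mat_mult_I_mat: "I_mat ** I_mat = (mat 1 :: 'n::finite imat)"
proof -
  have "(I_mat ** I_mat) $ i $ j = (mat 1 :: 'n imat) $ i $ j" for i j
    by (cases i; cases j)
      (simp_all add: matrix_matrix_mult_def I_mat_nth mat_def if_distrib[of "\<lambda>t. t * u" for u] cong: if_cong)
  then show ?thesis by (simp add: vec_eq_iff)
qed

text \<open>Without this the sign of a matrix would not be determined by the matrix.\<close>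

lemma I_mat_neq_uminus: "I_mat \<noteq> - (I_mat :: 'n::finite imat)"
proof
  assume eq: "I_mat = - (I_mat :: 'n imat)"
  have "(I_mat :: 'n imat) $ Inl x $ Inr x = (- I_mat) $ Inl x $ Inr x" for x
    by (subst eq[symmetric]) (rule refl)
  then show False by (simp add: I_mat_nth)
qed

lemma mat_sign_mult_I: "mat 1 ** I_mat = I_mat" "mat (-1) ** I_mat = - I_mat"
  by (simp_all add: vec_eq_iff mat_mult_nth)

lemma O_pm_form: "A \<in> carrier O_pm \<Longrightarrow> transpose A ** I_mat ** A = mat (iso_sign A) ** I_mat"
  by (auto simp: O_pm_def iso_sign_def mat_sign_mult_I)

lemma iso_sign_cases: "iso_sign A = 1 \<or> iso_sign A = -1"
  by (simp add: iso_sign_def)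

lemma iso_sign_square: "iso_sign A * iso_sign A = 1"
  using iso_sign_cases[of A] by auto

lemma O_pmI:
  assumes "A ** A' = mat 1" "A' ** A = mat 1"
    and form: "transpose A ** I_mat ** A = mat k ** I_mat" and k: "k = 1 \<or> k = -1"
  shows "A \<in> carrier O_pm" "iso_sign A = k"
proof -
  have "invertible A" unfolding invertible_def using assms(1,2) by blast
  then show "A \<in> carrier O_pm" "iso_sign A = k"
    using form k I_mat_neq_uminus by (auto simp: O_pm_def iso_sign_def mat_sign_mult_I)
qed

text \<open>The last conclusion is the source of the formula for the action: multiplying \<open>A\<^sup>t I A = \<epsilon> I\<close> by the
  inverse transpose of \<open>A\<close> on the left and by \<open>I\<close> on the right gives \<open>I A I\<close> as \<open>\<epsilon>\<close> times that inverse
  transpose.\<close>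

lemma O_pm_inverse:
  assumes A: "A \<in> carrier O_pm"
  obtains A' where "A' \<in> carrier O_pm" "A ** A' = mat 1" "A' ** A = mat 1" "iso_sign A' = iso_sign A"
    "mat (iso_sign A) ** transpose A' = I_mat ** A ** I_mat"
proof -
  obtain A' where A': "A ** A' = mat 1" "A' ** A = mat 1"
    using A by (auto simp: O_pm_def invertible_def)
  let ?k = "mat (iso_sign A) :: 'a imat"
  have kk: "?k ** ?k = mat 1"
    by (simp add: mat_mult_mat iso_sign_square)
  have tt: "transpose A' ** transpose A = mat 1"
    using A'(1) by (metis matrix_transpose_mul transpose_mat)
  have IA: "I_mat ** A = ?k ** transpose A' ** I_mat"
  proof -
    have "I_mat ** A = (transpose A' ** transpose A) ** I_mat ** A" by (simp add: tt)
    also have "\<dots> = transpose A' ** (transpose A ** I_mat ** A)" by (simp only: matrix_mul_assoc)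
    also have "\<dots> = transpose A' ** ?k ** I_mat" by (simp only: O_pm_form[OF A] matrix_mul_assoc)
    finally show ?thesis by (simp only: mat_commute)
  qed
  have adj: "?k ** transpose A' = I_mat ** A ** I_mat"
    unfolding IA by (simp only: matrix_mul_assoc[symmetric] I_mat_mult_I_mat matrix_mul_rid)
  have "transpose A' ** I_mat ** A' = (?k ** ?k) ** transpose A' ** I_mat ** A'" by (simp add: kk)
  also have "\<dots> = ?k ** (?k ** transpose A' ** I_mat) ** A'" by (simp only: matrix_mul_assoc)
  also have "\<dots> = ?k ** I_mat ** (A ** A')" by (simp only: IA[symmetric] matrix_mul_assoc)
  finally have form: "transpose A' ** I_mat ** A' = ?k ** I_mat" by (simp add: A')
  show ?thesis
    by (rule that[OF O_pmI(1)[OF A'(2,1) form iso_sign_cases] A' O_pmI(2)[OF A'(2,1) form iso_sign_cases] adj])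
qed

lemma O_pm_mult:
  assumes A: "A \<in> carrier O_pm" and B: "B \<in> carrier O_pm"
  shows "A ** B \<in> carrier O_pm" "iso_sign (A ** B) = iso_sign A * iso_sign B"
proof -
  obtain A' where A': "A ** A' = mat 1" "A' ** A = mat 1" using O_pm_inverse[OF A] by blast
  obtain B' where B': "B ** B' = mat 1" "B' ** B = mat 1" using O_pm_inverse[OF B] by blast
  have "A ** B ** (B' ** A') = A ** (B ** B') ** A'" by (simp only: matrix_mul_assoc)
  then have 1: "A ** B ** (B' ** A') = mat 1" by (simp add: A' B')
  have "B' ** A' ** (A ** B) = B' ** (A' ** A) ** B" by (simp only: matrix_mul_assoc)
  then have 2: "B' ** A' ** (A ** B) = mat 1" by (simp add: A' B')
  have "transpose (A ** B) ** I_mat ** (A ** B) = transpose B ** (transpose A ** I_mat ** A) ** B"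
    by (simp only: matrix_transpose_mul matrix_mul_assoc)
  also have "\<dots> = transpose B ** mat (iso_sign A) ** I_mat ** B"
    by (simp only: O_pm_form[OF A] matrix_mul_assoc)
  also have "\<dots> = mat (iso_sign A) ** (transpose B ** I_mat ** B)"
    by (simp only: mat_commute matrix_mul_assoc)
  also have "\<dots> = mat (iso_sign A * iso_sign B) ** I_mat"
    by (simp only: O_pm_form[OF B] matrix_mul_assoc mat_mult_mat)
  finally have form: "transpose (A ** B) ** I_mat ** (A ** B) = mat (iso_sign A * iso_sign B) ** I_mat" .
  have k: "iso_sign A * iso_sign B = 1 \<or> iso_sign A * iso_sign B = -1"
    using iso_sign_cases[of A] iso_sign_cases[of B] by auto
  show "A ** B \<in> carrier O_pm" "iso_sign (A ** B) = iso_sign A * iso_sign B"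
    by (rule O_pmI[OF 1 2 form k])+
qed

lemma O_pm_scalar:
  assumes k: "k * k = 1"
  shows "(mat k :: 'n::finite imat) \<in> carrier O_pm" "iso_sign (mat k :: 'n imat) = 1"
proof -
  have kk: "mat k ** mat k = (mat 1 :: 'n imat)" by (simp only: mat_mult_mat k)
  have "transpose (mat k) ** I_mat ** mat k = mat k ** mat k ** (I_mat :: 'n imat)"
    by (simp only: transpose_mat mat_commute[of I_mat] matrix_mul_assoc[symmetric])
  then have form: "transpose (mat k) ** I_mat ** mat k = mat 1 ** (I_mat :: 'n imat)"
    by (simp only: kk)
  show "(mat k :: 'n imat) \<in> carrier O_pm" "iso_sign (mat k :: 'n imat) = 1"
    by (rule O_pmI[OF kk kk form]; simp)+
qed

lemma group_O_pm: "group (O_pm :: 'n::finite imat monoid)"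
proof (rule groupI)
  fix A B C :: "'n imat"
  show "\<one>\<^bsub>O_pm\<^esub> \<in> carrier (O_pm :: 'n imat monoid)"
    using O_pm_scalar(1)[of 1] by (simp add: O_pm_def)
  show "\<one>\<^bsub>O_pm\<^esub> \<otimes>\<^bsub>O_pm\<^esub> A = A" "A \<otimes>\<^bsub>O_pm\<^esub> B \<otimes>\<^bsub>O_pm\<^esub> C = A \<otimes>\<^bsub>O_pm\<^esub> (B \<otimes>\<^bsub>O_pm\<^esub> C)"
    by (simp_all add: O_pm_def matrix_mul_assoc)
  assume A: "A \<in> carrier O_pm"
  show "\<exists>B\<in>carrier O_pm. B \<otimes>\<^bsub>O_pm\<^esub> A = \<one>\<^bsub>O_pm\<^esub>"
    by (rule O_pm_inverse[OF A], rule bexI) (simp_all add: O_pm_def)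
  assume B: "B \<in> carrier O_pm"
  show "A \<otimes>\<^bsub>O_pm\<^esub> B \<in> carrier O_pm"
    using O_pm_mult(1)[OF A B] by (simp add: O_pm_def)
qed

section \<open>Objects over a given matrix\<close>

text \<open>The bracket is a bilinear form whose symmetrization is the quadratic form \<open>I\<close> preserved up to sign; in
  matrices, \<open>J + J\<^sup>t = I\<close>.\<close>

lemma bracket_swap:
  fixes a b :: "'n::finite rvec"
  shows "bracket a b + bracket b a = a \<bullet> (real_mat I_mat *v b)"
proof -
  have "bracket b a = a \<bullet> (transpose J_mat *v b)"
    unfolding bracket_def by (metis dot_lmul_matrix inner_commute transpose_matrix_vector)
  moreover have "real_mat I_mat = J_mat + transpose (J_mat :: real ^ ('n + 'n) ^ ('n + 'n))"
    by (auto simp: vec_eq_iff real_mat_def I_mat_def J_mat_def block_matrix_def transpose_def mat_def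
        split: sum.split)
  ultimately show ?thesis
    by (simp add: bracket_def matrix_vector_mult_add_rdistrib inner_add_right del: transpose_matrix_vector)
qed

lemma bracket_add_left: "bracket (a + a') b = bracket a b + bracket a' b"
  by (simp add: bracket_def inner_add_left)

lemma bracket_add_right: "bracket a (b + b') = bracket a b + bracket a b'"
  by (simp add: bracket_def matrix_vector_right_distrib inner_add_right)

lemma bracket_scale_left: "bracket (r *\<^sub>R a) b = r * bracket a b"
  by (simp add: bracket_def)

lemma bracket_scale_right: "bracket a (r *\<^sub>R b) = r * bracket a b"
  by (simp add: bracket_def matrix_vector_mult_scaleR)

lemma bracket_real_vec:
  fixes m m' :: "'n::finite ivec"
  shows "bracket (real_vec m) (real_vec m') \<in> \<int>"
proof -
  define K :: "'n imat" where "K = block_matrix 0 0 (mat 1) 0"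
  have JK: "J_mat = real_mat K"
    by (auto simp: vec_eq_iff real_mat_def K_def J_mat_def block_matrix_def mat_def split: sum.split)
  have J: "J_mat *v real_vec m' = real_vec (K *v m')"
    unfolding JK by (rule real_mat_times_real_vec)
  show ?thesis
    unfolding bracket_def J by (auto simp: inner_vec_def real_vec_def intro!: Ints_sum Ints_mult)
qed

text \<open>By \<open>bracket_swap\<close> the symmetrization of the difference is the defect of \<open>A\<close> from preserving \<open>I\<close> up to
  sign, which is zero.\<close>

lemma skew_defect:
  assumes A: "A \<in> carrier O_pm"
  defines "\<Phi> \<equiv> \<lambda>a b. bracket (real_mat A *v a) (real_mat A *v b) - of_int (iso_sign A) * bracket a b"
  shows "\<Phi> a b = - \<Phi> b a"
proof -
  let ?R = "real_mat A" and ?I = "real_mat I_mat :: real ^ ('a + 'a) ^ ('a + 'a)"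
  have "(?R *v a) \<bullet> (?I *v (?R *v b)) = a \<bullet> (real_mat (transpose A ** I_mat ** A) *v b)"
    by (simp add: real_mat_mult real_mat_transpose matrix_vector_mul_assoc[symmetric])
      (metis dot_lmul_matrix inner_commute transpose_matrix_vector)
  also have "\<dots> = of_int (iso_sign A) * (a \<bullet> (?I *v b))"
    by (simp add: O_pm_form[OF A] real_mat_mult matrix_vector_mul_assoc[symmetric] real_mat_mat)
  finally have "bracket (?R *v a) (?R *v b) + bracket (?R *v b) (?R *v a)
      = of_int (iso_sign A) * (bracket a b + bracket b a)"
    by (simp only: bracket_swap)
  then show ?thesis by (simp add: \<Phi>_def algebra_simps)
qed

lemma bilinear_expand:
  fixes \<Phi> :: "real ^ 'k::finite \<Rightarrow> real ^ 'k \<Rightarrow> real"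
  assumes "bilinear \<Phi>"
  shows "\<Phi> a b = (\<Sum>i\<in>UNIV. \<Sum>j\<in>UNIV. a $ i * b $ j * \<Phi> (axis i 1) (axis j 1))"
proof -
  have e: "x = (\<Sum>i\<in>UNIV. x $ i *\<^sub>R axis i 1)" for x :: "real ^ 'k"
    by (simp only: basis_expansion scalar_mult_eq_scaleR[symmetric])
  have "\<Phi> a b = \<Phi> (\<Sum>i\<in>UNIV. a $ i *\<^sub>R axis i 1) (\<Sum>j\<in>UNIV. b $ j *\<^sub>R axis j 1)"
    by (simp only: e[symmetric])
  also have "\<dots> = (\<Sum>(i, j)\<in>UNIV \<times> UNIV. \<Phi> (a $ i *\<^sub>R axis i 1) (b $ j *\<^sub>R axis j 1))"
    by (rule bilinear_sum[OF assms])
  finally show ?thesis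
    by (simp add: sum.cartesian_product bilinear_lmul[OF assms] bilinear_rmul[OF assms] ac_simps)
qed

text \<open>An integral skew-symmetric matrix is the antisymmetrization of its strictly triangular half, which is
  still integral. Halving the form instead would destroy integrality on the lattice.\<close>

lemma skew_form_is_antisymmetrization:
  fixes \<Phi> :: "'n::finite rvec \<Rightarrow> 'n rvec \<Rightarrow> real"
  assumes bil: "bilinear \<Phi>" and skew: "\<And>a b. \<Phi> a b = - \<Phi> b a"
    and integral: "\<And>m m'. \<Phi> (real_vec m) (real_vec m') \<in> \<int>"
  obtains H where "smooth_real_on UNIV H"
    "\<And>a a' b. H (a + a', b) = H (a, b) + H (a', b)"
    "\<And>a b b'. H (a, b + b') = H (a, b) + H (a, b')"
    "\<And>m m'. H (real_vec m, real_vec m') \<in> \<int>"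
    "\<And>a b. H (b, a) - H (a, b) = \<Phi> a b"
proof -
  \<comment> \<open>the index type carries no order, so one is transported from the natural numbers\<close>
  obtain f :: "'n + 'n \<Rightarrow> nat" where f: "inj f"
    using finite_imp_inj_to_nat_seg[OF finite_class.finite_UNIV] by metis
  define N where "N i j = (if f i < f j then - \<Phi> (axis i 1) (axis j 1) else 0)" for i j
  define H where "H p = (\<Sum>i\<in>UNIV. \<Sum>j\<in>UNIV. (fst p $ i * snd p $ j) * N i j)" for p
  have N: "N j i - N i j = \<Phi> (axis i 1) (axis j 1)" for i j
  proof (cases "i = j")
    case True
    then show ?thesis using skew[of "axis i 1" "axis i 1"] by (simp add: N_def)
  next
    case False
    then have "f i \<noteq> f j" using f by (simp add: inj_eq)
    then show ?thesis using skew[of "axis i 1" "axis j 1"] by (auto simp: N_def)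
  qed
  have N_int: "N i j \<in> \<int>" for i j
    using integral[of "axis i 1" "axis j 1"] by (auto simp: N_def real_vec_axis)
  show ?thesis
  proof (rule that)
    have "bounded_linear (\<lambda>p::'n rvec \<times> 'n rvec. fst p $ i)" "bounded_linear (\<lambda>p::'n rvec \<times> 'n rvec. snd p $ i)" for i
      by (rule bounded_linear_compose[OF bounded_linear_vec_nth bounded_linear_fst]
            bounded_linear_compose[OF bounded_linear_vec_nth bounded_linear_snd])+
    then show "smooth_real_on UNIV H"
      unfolding H_def
      by (intro smooth_real_on_sum smooth_real_on_mult smooth_real_on_const smooth_real_on_bounded_linear
          open_UNIV)
    show "H (a + a', b) = H (a, b) + H (a', b)" for a a' b
      by (simp add: H_def algebra_simps sum.distrib)
    show "H (a, b + b') = H (a, b) + H (a, b')" for a b b'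
      by (simp add: H_def algebra_simps sum.distrib)
    show "H (real_vec m, real_vec m') \<in> \<int>" for m m'
      using N_int by (auto simp: H_def real_vec_def intro!: Ints_sum Ints_mult)
    show "H (b, a) - H (a, b) = \<Phi> a b" for a b
    proof -
      have "H (b, a) = (\<Sum>i\<in>UNIV. \<Sum>j\<in>UNIV. (a $ i * b $ j) * N j i)"
        unfolding H_def by (subst sum.swap) (simp add: mult.commute)
      then show ?thesis
        by (simp add: H_def bilinear_expand[OF bil, of a b] N[symmetric] right_diff_distrib sum_subtractf)
    qed
  qed
qed

text \<open>Surjectivity of the projection. The second axiom prescribes the antisymmetrization of \<open>\<eta>\<close> on lattice vectors
  to be the form \<open>[Aa,Ab] - \<epsilon>[a,b]\<close>, which is skew and integral; a bilinear \<open>\<eta>\<close> with this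
  antisymmetrization and integral values on the lattice satisfies the other axioms for trivial reasons.\<close>

theorem AA_obj_exists:
  assumes A: "A \<in> carrier O_pm"
  obtains \<eta> where "is_AA_obj (A, \<eta>)"
proof -
  define \<Phi> where "\<Phi> a b = bracket (real_mat A *v a) (real_mat A *v b) - of_int (iso_sign A) * bracket a b" for a b
  have bil: "bilinear \<Phi>"
    unfolding bilinear_def linear_iff \<Phi>_def
    by (simp add: matrix_vector_right_distrib matrix_vector_mult_scaleR bracket_add_left bracket_add_right
        bracket_scale_left bracket_scale_right algebra_simps)
  have skew: "\<Phi> a b = - \<Phi> b a" for a b
    unfolding \<Phi>_def by (rule skew_defect[OF A])
  have int: "\<Phi> (real_vec m) (real_vec m') \<in> \<int>" for m m'
    by (auto simp: \<Phi>_def real_mat_times_real_vec intro!: Ints_diff Ints_mult bracket_real_vec)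
  obtain H where H: "smooth_real_on UNIV H"
    "\<And>a a' b. H (a + a', b) = H (a, b) + H (a', b)"
    "\<And>a b b'. H (a, b + b') = H (a, b) + H (a, b')"
    "\<And>m m'. H (real_vec m, real_vec m') \<in> \<int>"
    "\<And>a b. H (b, a) - H (a, b) = \<Phi> a b"
    using skew_form_is_antisymmetrization[OF bil skew int] by blast
  have "is_AA_obj (A, \<lambda>p. mod_Z (H p))"
    unfolding is_AA_obj_def prod.case
  proof (intro conjI allI)
    show "mod_Z (H (real_vec m, a)) + mod_Z (of_int (iso_sign A) * bracket a (real_vec m)) =
        mod_Z (H (a, real_vec m)) + mod_Z (bracket (real_mat A *v a) (real_mat A *v real_vec m))" for a m
    proof -
      have "H (real_vec m, a) + of_int (iso_sign A) * bracket a (real_vec m) =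
          H (a, real_vec m) + bracket (real_mat A *v a) (real_mat A *v real_vec m)"
        using H(5)[of "real_vec m" a] by (simp add: \<Phi>_def algebra_simps)
      then show ?thesis by (simp only: mod_Z_add)
    qed
  qed (use A H in \<open>auto simp: smooth_u1I mod_Z_add mod_Z_eq_0_iff add_ac\<close>)
  then show ?thesis by (rule that)
qed

section \<open>The groups of objects and of morphisms\<close>

lemma is_AA_objD:
  assumes "is_AA_obj x"
  shows "fst x \<in> carrier O_pm" "smooth_u1 (snd x)"
    "snd x (real_vec m, real_vec m') = 0"
    "snd x (real_vec m, a) + mod_Z (of_int (iso_sign (fst x)) * bracket a (real_vec m)) =
      snd x (a, real_vec m) + mod_Z (bracket (real_mat (fst x) *v a) (real_mat (fst x) *v real_vec m))"
    "snd x (a, a') + snd x (a + a', a'') = snd x (a', a'') + snd x (a, a' + a'')"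
  using assms by (cases x; simp add: is_AA_obj_def)+

lemma AA_obj_mult_eq:
  "AA_obj_mult x y = (fst x ** fst y,
    \<lambda>p. snd x (real_mat (fst y) *v fst p, real_mat (fst y) *v snd p) + iso_sign (fst x) *\<^sub>Z snd y p)"
  by (cases x; cases y) (simp add: AA_obj_mult_def fun_eq_iff)

lemma smooth_u1_twisted_sum:
  assumes "smooth_u1 f" "smooth_u1 g"
  shows "smooth_u1 (\<lambda>a. f (real_mat A *v a) + k *\<^sub>Z g a)"
  by (intro smooth_u1_add smooth_u1_zscale smooth_u1_compose_linear[OF assms(1)] assms bounded_linear_real_mat)

lemma smooth_u1_compose_pair:
  assumes "smooth_u1 f"
  shows "smooth_u1 (\<lambda>p. f (real_mat A *v fst p, real_mat A *v snd p))"
proof (rule smooth_u1_compose_linear[OF assms])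
  show "bounded_linear (\<lambda>p. (real_mat A *v fst p, real_mat A *v snd p))"
    by (intro bounded_linear_Pair bounded_linear_compose[OF bounded_linear_real_mat]
        bounded_linear_fst bounded_linear_snd)
qed

text \<open>The shape in which the second axiom for two factors adds up to the one for their product: the term
  \<open>\<epsilon>\<^sub>1 [A\<^sub>2 a, A\<^sub>2 m]\<close> occurs on opposite sides and drops out.\<close>

lemma add_equations_cancel:
  fixes s :: "'a::ab_group_add"
  assumes "x\<^sub>1 + s = y\<^sub>1 + t" "x\<^sub>2 + u = y\<^sub>2 + s"
  shows "x\<^sub>1 + x\<^sub>2 + u = y\<^sub>1 + y\<^sub>2 + t"
proof -
  have "(x\<^sub>1 + x\<^sub>2 + u) + s = (x\<^sub>1 + s) + (x\<^sub>2 + u)" by (simp only: ac_simps)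
  also have "\<dots> = (y\<^sub>1 + t) + (y\<^sub>2 + s)" by (simp only: assms)
  also have "\<dots> = (y\<^sub>1 + y\<^sub>2 + t) + s" by (simp only: ac_simps)
  finally show ?thesis by (simp only: add_right_cancel)
qed

lemma move_negatives:
  fixes s :: "'a::ab_group_add"
  assumes "u + - s = v + - t"
  shows "u + t = v + s"
proof -
  have "u + t = (u + - s) + (s + t)" by simp
  also have "\<dots> = (v + - t) + (t + s)" by (simp only: assms add.commute[of s])
  also have "\<dots> = v + s" by simp
  finally show ?thesis .
qed

lemma AA_obj_mult_closed:
  assumes x: "is_AA_obj x" and y: "is_AA_obj y"
  shows "is_AA_obj (AA_obj_mult x y)"
proof -
  let ?A = "fst x" and ?B = "fst y"
  note O = is_AA_objD(1)[OF x] is_AA_objD(1)[OF y]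
  show ?thesis
    unfolding AA_obj_mult_eq is_AA_obj_def prod.case
  proof (intro conjI allI)
    show "?A ** ?B \<in> carrier O_pm" by (rule O_pm_mult[OF O])
    show "smooth_u1 (\<lambda>p. snd x (real_mat ?B *v fst p, real_mat ?B *v snd p) + iso_sign ?A *\<^sub>Z snd y p)"
      by (intro smooth_u1_add smooth_u1_zscale smooth_u1_compose_pair is_AA_objD(2) x y)
  next
    fix m m'
    show "snd x (real_mat ?B *v fst (real_vec m, real_vec m'), real_mat ?B *v snd (real_vec m, real_vec m'))
        + iso_sign ?A *\<^sub>Z snd y (real_vec m, real_vec m') = 0"
      by (simp add: real_mat_times_real_vec is_AA_objD(3)[OF x] is_AA_objD(3)[OF y])
  next
    fix a m
    have ex: "snd x (real_mat ?B *v real_vec m, real_mat ?B *v a) +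
        mod_Z (of_int (iso_sign ?A) * bracket (real_mat ?B *v a) (real_mat ?B *v real_vec m)) =
      snd x (real_mat ?B *v a, real_mat ?B *v real_vec m) +
        mod_Z (bracket (real_mat ?A *v (real_mat ?B *v a)) (real_mat ?A *v (real_mat ?B *v real_vec m)))"
      using is_AA_objD(4)[OF x, of "?B *v m" "real_mat ?B *v a"] by (simp only: real_mat_times_real_vec)
    have ey: "iso_sign ?A *\<^sub>Z snd y (real_vec m, a) +
        mod_Z (of_int (iso_sign ?A) * (of_int (iso_sign ?B) * bracket a (real_vec m))) =
      iso_sign ?A *\<^sub>Z snd y (a, real_vec m) +
        mod_Z (of_int (iso_sign ?A) * bracket (real_mat ?B *v a) (real_mat ?B *v real_vec m))"
      using arg_cong[OF is_AA_objD(4)[OF y, of m a], of "zscale (iso_sign ?A)"]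
      by (simp only: zscale_add_right zscale_mod_Z)
    show "snd x (real_mat ?B *v fst (real_vec m, a), real_mat ?B *v snd (real_vec m, a))
        + iso_sign ?A *\<^sub>Z snd y (real_vec m, a)
        + mod_Z (of_int (iso_sign (?A ** ?B)) * bracket a (real_vec m)) =
      snd x (real_mat ?B *v fst (a, real_vec m), real_mat ?B *v snd (a, real_vec m))
        + iso_sign ?A *\<^sub>Z snd y (a, real_vec m)
        + mod_Z (bracket (real_mat (?A ** ?B) *v a) (real_mat (?A ** ?B) *v real_vec m))"
      using add_equations_cancel[OF ex ey]
      by (simp only: fst_conv snd_conv O_pm_mult(2)[OF O] real_mat_mult matrix_vector_mul_assoc of_int_mult mult.assoc)
  next
    fix a a' a''
    show "snd x (real_mat ?B *v fst (a, a'), real_mat ?B *v snd (a, a')) + iso_sign ?A *\<^sub>Z snd y (a, a')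
      + (snd x (real_mat ?B *v fst (a + a', a''), real_mat ?B *v snd (a + a', a''))
        + iso_sign ?A *\<^sub>Z snd y (a + a', a'')) =
      snd x (real_mat ?B *v fst (a', a''), real_mat ?B *v snd (a', a'')) + iso_sign ?A *\<^sub>Z snd y (a', a'')
      + (snd x (real_mat ?B *v fst (a, a' + a''), real_mat ?B *v snd (a, a' + a''))
        + iso_sign ?A *\<^sub>Z snd y (a, a' + a''))"
      using arg_cong2[of _ _ _ _ "(+)", OF is_AA_objD(5)[OF x, of "real_mat ?B *v a" "real_mat ?B *v a'" "real_mat ?B *v a''"]
          arg_cong[OF is_AA_objD(5)[OF y, of a a' a''], of "zscale (iso_sign ?A)"]]
      by (simp only: fst_conv snd_conv zscale_add_right matrix_vector_right_distrib ac_simps)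
  qed
qed

lemma AA_obj_mult_assoc:
  assumes "is_AA_obj x" "is_AA_obj y"
  shows "AA_obj_mult (AA_obj_mult x y) z = AA_obj_mult x (AA_obj_mult y z)"
  using O_pm_mult(2)[OF is_AA_objD(1)[OF assms(1)] is_AA_objD(1)[OF assms(2)]]
  by (simp add: AA_obj_mult_eq matrix_mul_assoc real_mat_mult matrix_vector_mul_assoc zscale_add_right
      zscale_zscale add.assoc)

lemma AA_one_simps [simp]: "fst AA_one = mat 1" "snd AA_one p = 0"
  by (simp_all add: AA_one_def)

lemma is_AA_obj_one: "is_AA_obj AA_one"
  by (simp add: AA_one_def is_AA_obj_def smooth_u1_zero real_mat_one O_pm_scalar)

lemma AA_obj_mult_one: "AA_obj_mult AA_one x = x" "AA_obj_mult x AA_one = x"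
  by (simp_all add: AA_obj_mult_eq AA_one_def real_mat_one O_pm_scalar)

text \<open>Solving \<open>\<eta>' (A a, A a') + \<epsilon> \<eta> (a, a') = 0\<close> dictates the inverse; its second axiom is that of \<open>x\<close> at the
  preimages of \<open>a\<close> and \<open>m\<close>, multiplied by \<open>- \<epsilon>\<close>. This uses that \<open>A\<close> maps the lattice onto itself.\<close>

lemma AA_obj_inverse:
  assumes x: "is_AA_obj x"
  shows "\<exists>y. is_AA_obj y \<and> AA_obj_mult y x = AA_one"
proof -
  let ?A = "fst x" and ?\<epsilon> = "iso_sign (fst x)"
  obtain A' where A': "A' \<in> carrier O_pm" "?A ** A' = mat 1" "A' ** ?A = mat 1" "iso_sign A' = ?\<epsilon>"
    using O_pm_inverse[OF is_AA_objD(1)[OF x]] by blast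
  define y where "y = (A', \<lambda>p. (- ?\<epsilon>) *\<^sub>Z snd x (real_mat A' *v fst p, real_mat A' *v snd p))"
  have inv: "real_mat ?A *v (real_mat A' *v a) = a" for a
    by (simp add: matrix_vector_mul_assoc real_mat_mult[symmetric] A' real_mat_one)
  have inv': "real_mat A' *v (real_mat ?A *v a) = a" for a
    by (simp add: matrix_vector_mul_assoc real_mat_mult[symmetric] A' real_mat_one)
  have "is_AA_obj y"
    unfolding y_def is_AA_obj_def prod.case
  proof (intro conjI allI)
    show "smooth_u1 (\<lambda>p. (- ?\<epsilon>) *\<^sub>Z snd x (real_mat A' *v fst p, real_mat A' *v snd p))"
      by (intro smooth_u1_zscale smooth_u1_compose_pair is_AA_objD(2) x)
  next
    fix m m'
    show "(- ?\<epsilon>) *\<^sub>Z snd x (real_mat A' *v fst (real_vec m, real_vec m'), real_mat A' *v snd (real_vec m, real_vec m')) = 0"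
      by (simp add: real_mat_times_real_vec is_AA_objD(3)[OF x])
  next
    fix a m
    have "(- ?\<epsilon>) *\<^sub>Z snd x (real_mat A' *v real_vec m, real_mat A' *v a)
        + - mod_Z (bracket (real_mat A' *v a) (real_mat A' *v real_vec m)) =
      (- ?\<epsilon>) *\<^sub>Z snd x (real_mat A' *v a, real_mat A' *v real_vec m)
        + - mod_Z (of_int ?\<epsilon> * bracket a (real_vec m))"
    proof -
      have "snd x (real_mat A' *v real_vec m, real_mat A' *v a)
          + mod_Z (of_int ?\<epsilon> * bracket (real_mat A' *v a) (real_mat A' *v real_vec m)) =
        snd x (real_mat A' *v a, real_mat A' *v real_vec m) + mod_Z (bracket a (real_vec m))"
        using is_AA_objD(4)[OF x, of "A' *v m" "real_mat A' *v a"]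
        by (simp only: real_mat_times_real_vec[symmetric] inv)
      from arg_cong[OF this, of "zscale (- ?\<epsilon>)"] show ?thesis
        using iso_sign_cases[of ?A]
        by (auto simp: zscale_add_right zscale_mod_Z mod_Z_minus)
    qed
    from move_negatives[OF this]
    show "(- ?\<epsilon>) *\<^sub>Z snd x (real_mat A' *v fst (real_vec m, a), real_mat A' *v snd (real_vec m, a))
        + mod_Z (of_int (iso_sign A') * bracket a (real_vec m)) =
      (- ?\<epsilon>) *\<^sub>Z snd x (real_mat A' *v fst (a, real_vec m), real_mat A' *v snd (a, real_vec m))
        + mod_Z (bracket (real_mat A' *v a) (real_mat A' *v real_vec m))"
      by (simp only: fst_conv snd_conv A'(4))
  next
    fix a a' a''
    show "(- ?\<epsilon>) *\<^sub>Z snd x (real_mat A' *v fst (a, a'), real_mat A' *v snd (a, a'))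
        + (- ?\<epsilon>) *\<^sub>Z snd x (real_mat A' *v fst (a + a', a''), real_mat A' *v snd (a + a', a'')) =
      (- ?\<epsilon>) *\<^sub>Z snd x (real_mat A' *v fst (a', a''), real_mat A' *v snd (a', a''))
        + (- ?\<epsilon>) *\<^sub>Z snd x (real_mat A' *v fst (a, a' + a''), real_mat A' *v snd (a, a' + a''))"
      using is_AA_objD(5)[OF x, of "real_mat A' *v a" "real_mat A' *v a'" "real_mat A' *v a''"]
      by (simp only: fst_conv snd_conv zscale_add_right[symmetric] matrix_vector_right_distrib)
  qed (rule A'(1))
  moreover have "AA_obj_mult y x = AA_one"
  proof -
    have "(- ?\<epsilon>) *\<^sub>Z u + ?\<epsilon> *\<^sub>Z u = 0" for u :: u1
      using iso_sign_cases[of ?A] by auto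
    then show ?thesis
      by (simp add: AA_obj_mult_eq y_def AA_one_def A' inv')
  qed
  ultimately show ?thesis by blast
qed

lemma is_AA_mor_iff:
  "is_AA_mor (x, \<beta>, y) \<longleftrightarrow> is_AA_obj x \<and> is_AA_obj y \<and> fst x = fst y \<and> smooth_u1 \<beta> \<and>
    (\<forall>m. \<beta> (real_vec m) = 0) \<and> (\<forall>a b. \<beta> a + \<beta> b + snd x (a, b) = snd y (a, b) + \<beta> (a + b))"
  by (cases x; cases y) (simp add: is_AA_mor_def)

lemma AA_mor_mult_eq:
  "AA_mor_mult (x, \<beta>, y) (x', \<beta>', y') =
    (AA_obj_mult x x', \<lambda>a. \<beta> (real_mat (fst x') *v a) + iso_sign (fst x) *\<^sub>Z \<beta>' a, AA_obj_mult y y')"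
  by (simp add: AA_mor_mult_def)

lemma AA_mor_mult_closed:
  assumes "is_AA_mor f" "is_AA_mor g"
  shows "is_AA_mor (AA_mor_mult f g)"
proof -
  obtain x \<beta> y x' \<beta>' y' where fg: "f = (x, \<beta>, y)" "g = (x', \<beta>', y')" by (metis prod_cases3)
  note f = assms(1)[unfolded fg is_AA_mor_iff] and g = assms(2)[unfolded fg is_AA_mor_iff]
  let ?B = "real_mat (fst x')" and ?k = "iso_sign (fst x)"
  have "smooth_u1 (\<lambda>a. \<beta> (?B *v a) + ?k *\<^sub>Z \<beta>' a)"
    using f g by (intro smooth_u1_twisted_sum) blast+
  moreover have "\<beta> (?B *v real_vec m) + ?k *\<^sub>Z \<beta>' (real_vec m) = 0" for m
    using f g by (simp add: real_mat_times_real_vec)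
  moreover have "\<beta> (?B *v a) + ?k *\<^sub>Z \<beta>' a + (\<beta> (?B *v b) + ?k *\<^sub>Z \<beta>' b) + snd (AA_obj_mult x x') (a, b) =
      snd (AA_obj_mult y y') (a, b) + (\<beta> (?B *v (a + b)) + ?k *\<^sub>Z \<beta>' (a + b))" for a b
  proof -
    have 1: "\<beta> (?B *v a) + \<beta> (?B *v b) + snd x (?B *v a, ?B *v b) =
        snd y (?B *v a, ?B *v b) + \<beta> (?B *v a + ?B *v b)"
      using f by blast
    have 2: "?k *\<^sub>Z (\<beta>' a + \<beta>' b + snd x' (a, b)) = ?k *\<^sub>Z (snd y' (a, b) + \<beta>' (a + b))"
      using g by simp
    have e: "fst y = fst x" "fst y' = fst x'" using f g by auto
    show ?thesis
      using arg_cong2[of _ _ _ _ "(+)", OF 1 2]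
      by (simp only: AA_obj_mult_eq e fst_conv snd_conv zscale_add_right matrix_vector_right_distrib ac_simps)
  qed
  moreover have "fst (AA_obj_mult x x') = fst (AA_obj_mult y y')"
    using f g by (simp add: AA_obj_mult_eq)
  moreover have "is_AA_obj (AA_obj_mult x x')" "is_AA_obj (AA_obj_mult y y')"
    using f g by (auto intro: AA_obj_mult_closed)
  ultimately show ?thesis
    unfolding fg AA_mor_mult_eq is_AA_mor_iff by blast
qed

lemma AA_mor_mult_assoc:
  assumes "is_AA_mor f" "is_AA_mor g"
  shows "AA_mor_mult (AA_mor_mult f g) h = AA_mor_mult f (AA_mor_mult g h)"
proof -
  obtain x \<beta> y x' \<beta>' y' x'' \<beta>'' y''
    where fgh: "f = (x, \<beta>, y)" "g = (x', \<beta>', y')" "h = (x'', \<beta>'', y'')" by (metis prod_cases3)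
  have obj: "is_AA_obj x" "is_AA_obj y" "is_AA_obj x'" "is_AA_obj y'"
    using assms by (auto simp: fgh is_AA_mor_iff)
  have "iso_sign (fst x ** fst x') = iso_sign (fst x) * iso_sign (fst x')"
    using obj by (intro O_pm_mult is_AA_objD)
  then show ?thesis
    unfolding fgh AA_mor_mult_eq AA_obj_mult_assoc[OF obj(1,3)] AA_obj_mult_assoc[OF obj(2,4)]
    by (simp add: AA_obj_mult_eq real_mat_mult matrix_vector_mul_assoc zscale_add_right zscale_zscale add.assoc)
qed

lemma is_AA_mor_idm: "is_AA_obj x \<Longrightarrow> is_AA_mor (AA_idm x)"
  by (simp add: AA_idm_def is_AA_mor_iff smooth_u1_zero)

lemma AA_idm_mult: "AA_idm (AA_obj_mult x y) = AA_mor_mult (AA_idm x) (AA_idm y)"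
  by (simp add: AA_idm_def AA_mor_mult_eq)

lemma AA_mor_one_mult: "AA_mor_mult (AA_idm AA_one) f = f"
  by (cases f)
    (simp add: AA_idm_def AA_mor_mult_eq AA_obj_mult_one, simp add: AA_one_def O_pm_scalar)

lemma AA_Obj_simps [simp]:
  "carrier (Obj AA) = Collect is_AA_obj" "monoid.mult (Obj AA) = AA_obj_mult" "one (Obj AA) = AA_one"
  by (auto simp: AA_def)

lemma group_AA_Obj: "group (Obj (AA :: 'n::finite AA_2_group))"
proof (rule groupI)
  fix x y z :: "'n AA_obj" assume "x \<in> carrier (Obj AA)" "y \<in> carrier (Obj AA)" "z \<in> carrier (Obj AA)"
  then show "x \<otimes>\<^bsub>Obj AA\<^esub> y \<otimes>\<^bsub>Obj AA\<^esub> z = x \<otimes>\<^bsub>Obj AA\<^esub> (y \<otimes>\<^bsub>Obj AA\<^esub> z)"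
    by (simp add: AA_obj_mult_assoc)
next
  fix x :: "'n AA_obj" assume "x \<in> carrier (Obj AA)"
  then show "\<exists>y\<in>carrier (Obj AA). y \<otimes>\<^bsub>Obj AA\<^esub> x = \<one>\<^bsub>Obj AA\<^esub>"
    using AA_obj_inverse[of x] by auto
qed (simp_all add: AA_obj_mult_closed is_AA_obj_one AA_obj_mult_one)

lemma AA_mor_reverse: "is_AA_mor (x, \<beta>, y) \<Longrightarrow> is_AA_mor (y, \<lambda>a. - \<beta> a, x)"
  unfolding is_AA_mor_iff
proof (elim conjE, intro conjI allI)
  fix a b
  assume "\<forall>a b. \<beta> a + \<beta> b + snd x (a, b) = snd y (a, b) + \<beta> (a + b)"
  then have "\<beta> a + \<beta> b + snd x (a, b) = snd y (a, b) + \<beta> (a + b)" by blast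
  then have "snd y (a, b) = \<beta> a + \<beta> b + snd x (a, b) - \<beta> (a + b)" by (simp add: eq_diff_eq)
  then show "- \<beta> a + - \<beta> b + snd y (a, b) = snd x (a, b) + - \<beta> (a + b)" by simp
qed (simp_all add: smooth_u1_minus)

lemma AA_mor_inverse:
  fixes x y :: "'n::finite AA_obj"
  assumes f: "is_AA_mor (x, \<beta>, y)"
  shows "\<exists>g. is_AA_mor g \<and> AA_mor_mult g (x, \<beta>, y) = AA_idm AA_one"
proof -
  have x: "is_AA_obj x" and y: "is_AA_obj y" and xy: "fst x = fst y" using f by (auto simp: is_AA_mor_iff)
  interpret group "Obj (AA :: 'n AA_2_group)" by (rule group_AA_Obj)
  define x' y' where "x' = inv\<^bsub>Obj AA\<^esub> x" and "y' = inv\<^bsub>Obj AA\<^esub> y"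
  have x': "is_AA_obj x'" "AA_obj_mult x' x = AA_one"
    using inv_closed[of x] l_inv[of x] x by (simp_all add: x'_def)
  have y': "is_AA_obj y'" "AA_obj_mult y' y = AA_one" "AA_obj_mult y y' = AA_one"
    using inv_closed[of y] l_inv[of y] r_inv[of y] y by (simp_all add: y'_def)
  \<comment> \<open>the tensor inverse in a strict 2-group: the reversed morphism \<open>y \<rightarrow> x\<close>, multiplied by \<open>x\<inverse>\<close> on the left
    and \<open>y\<inverse>\<close> on the right, which gives a morphism \<open>x\<inverse> \<rightarrow> y\<inverse>\<close>\<close>
  define g where "g = AA_mor_mult (AA_mor_mult (AA_idm x') (y, \<lambda>a. - \<beta> a, x)) (AA_idm y')"
  have rev: "is_AA_mor (y, \<lambda>a. - \<beta> a, x)" by (rule AA_mor_reverse[OF f])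
  have "is_AA_mor g"
    unfolding g_def by (intro AA_mor_mult_closed is_AA_mor_idm rev x' y')
  moreover have "AA_mor_mult g (x, \<beta>, y) = AA_idm AA_one"
  proof -
    have src: "AA_obj_mult (AA_obj_mult x' y) y' = x'"
      using AA_obj_mult_assoc[OF x'(1) y] y'(3) by (simp add: AA_obj_mult_one)
    have tgt: "AA_obj_mult (AA_obj_mult x' x) y' = y'"
      using x'(2) by (simp add: AA_obj_mult_one)
    have "fst y' ** fst y = mat 1"
      using y'(2) by (simp add: AA_obj_mult_eq AA_one_def)
    then have inv: "real_mat (fst y') *v (real_mat (fst x) *v a) = a" for a
      by (simp add: xy matrix_vector_mul_assoc real_mat_mult[symmetric] real_mat_one)
    show ?thesis
      by (simp add: g_def AA_idm_def AA_mor_mult_eq AA_obj_mult_one src tgt x'(2) y'(2) inv zscale_minus_right)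
  qed
  ultimately show ?thesis by blast
qed

lemma AA_Mor_simps [simp]:
  "carrier (Mor AA) = Collect is_AA_mor" "monoid.mult (Mor AA) = AA_mor_mult" "one (Mor AA) = AA_idm AA_one"
  by (auto simp: AA_def)

lemma AA_structure_simps [simp]:
  "src AA (x, \<beta>, y) = x" "tgt AA (x, \<beta>, y) = y" "idm AA = AA_idm"
  "cmp AA (y, \<beta>', z) (x, \<beta>, y') = (x, \<lambda>a. \<beta>' a + \<beta> a, z)"
  by (simp_all add: AA_def)

lemma group_AA_Mor: "group (Mor (AA :: 'n::finite AA_2_group))"
proof (rule groupI)
  fix f g h :: "'n AA_mor" assume "f \<in> carrier (Mor AA)" "g \<in> carrier (Mor AA)" "h \<in> carrier (Mor AA)"
  then show "f \<otimes>\<^bsub>Mor AA\<^esub> g \<otimes>\<^bsub>Mor AA\<^esub> h = f \<otimes>\<^bsub>Mor AA\<^esub> (g \<otimes>\<^bsub>Mor AA\<^esub> h)"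
    by (simp add: AA_mor_mult_assoc)
next
  fix f :: "'n AA_mor" assume "f \<in> carrier (Mor AA)"
  then show "\<exists>g\<in>carrier (Mor AA). g \<otimes>\<^bsub>Mor AA\<^esub> f = \<one>\<^bsub>Mor AA\<^esub>"
    using AA_mor_inverse by (cases f) auto
qed (simp_all add: AA_mor_mult_closed is_AA_mor_idm is_AA_obj_one AA_mor_one_mult)

lemma AA_mor_comp_closed:
  assumes "is_AA_mor (x, \<beta>, y)" "is_AA_mor (y, \<beta>', z)"
  shows "is_AA_mor (x, \<lambda>a. \<beta>' a + \<beta> a, z)"
proof -
  have "\<beta>' a + \<beta> a + (\<beta>' b + \<beta> b) + snd x (a, b) = snd z (a, b) + (\<beta>' (a + b) + \<beta> (a + b))" for a b
  proof -
    have 1: "\<beta> a + \<beta> b + snd x (a, b) = snd y (a, b) + \<beta> (a + b)"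
      and 2: "\<beta>' a + \<beta>' b + snd y (a, b) = snd z (a, b) + \<beta>' (a + b)"
      using assms unfolding is_AA_mor_iff by blast+
    have "\<beta>' a + \<beta> a + (\<beta>' b + \<beta> b) + snd x (a, b) = \<beta>' a + \<beta>' b + (\<beta> a + \<beta> b + snd x (a, b))"
      by (simp only: ac_simps)
    also have "\<dots> = (\<beta>' a + \<beta>' b + snd y (a, b)) + \<beta> (a + b)" unfolding 1 by (simp only: add.assoc)
    also have "\<dots> = snd z (a, b) + (\<beta>' (a + b) + \<beta> (a + b))" unfolding 2 by (simp only: add.assoc)
    finally show ?thesis .
  qed
  with assms show ?thesis
    unfolding is_AA_mor_iff by (simp add: smooth_u1_add)
qed

theorem strict_2_group_AA: "strict_2_group (AA :: 'n::finite AA_2_group)"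
proof (rule strict_2_group.intro)
  show "group (Obj (AA :: 'n AA_2_group))" by (rule group_AA_Obj)
  show "group (Mor (AA :: 'n AA_2_group))" by (rule group_AA_Mor)
  show "src AA \<in> hom (Mor AA) (Obj (AA :: 'n AA_2_group))" "tgt AA \<in> hom (Mor AA) (Obj (AA :: 'n AA_2_group))"
    by (auto simp: hom_def AA_mor_mult_eq is_AA_mor_iff)
  show "idm AA \<in> hom (Obj AA) (Mor (AA :: 'n AA_2_group))"
    by (auto simp: hom_def is_AA_mor_idm AA_idm_mult)
next
  fix x :: "'n AA_obj" assume "x \<in> carrier (Obj AA)"
  show "src AA (idm AA x) = x" "tgt AA (idm AA x) = x" by (simp_all add: AA_idm_def)
next
  fix f :: "'n AA_mor" assume f: "f \<in> carrier (Mor AA)"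
  obtain x \<beta> y where [simp]: "f = (x, \<beta>, y)" by (metis prod_cases3)
  show "cmp AA f (idm AA (src AA f)) = f" "cmp AA (idm AA (tgt AA f)) f = f"
    by (simp_all add: AA_idm_def)
  have "is_AA_mor (y, \<lambda>a. - \<beta> a, x)" using f by (simp add: AA_mor_reverse)
  then show "\<exists>g\<in>carrier (Mor AA). src AA g = tgt AA f \<and> tgt AA g = src AA f \<and>
      cmp AA g f = idm AA (src AA f) \<and> cmp AA f g = idm AA (tgt AA f)"
    by (intro bexI[of _ "(y, \<lambda>a. - \<beta> a, x)"]) (simp_all add: AA_idm_def)
next
  fix f g :: "'n AA_mor"
  assume f: "f \<in> carrier (Mor AA)" and g: "g \<in> carrier (Mor AA)" and fg: "tgt AA f = src AA g"
  obtain x \<beta> y z \<beta>' where [simp]: "f = (x, \<beta>, y)" "g = (y, \<beta>', z)"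
    using fg by (cases f; cases g) simp
  show "cmp AA g f \<in> carrier (Mor AA)"
    using f g AA_mor_comp_closed by simp
  show "src AA (cmp AA g f) = src AA f" "tgt AA (cmp AA g f) = tgt AA g" by simp_all
next
  fix f g h :: "'n AA_mor"
  show "cmp AA h (cmp AA g f) = cmp AA (cmp AA h g) f"
    by (cases f; cases g; cases h) (simp add: add.assoc)
next
  fix f g f' g' :: "'n AA_mor"
  assume "f \<in> carrier (Mor AA)" "g \<in> carrier (Mor AA)" "tgt AA f = src AA g"
    and "f' \<in> carrier (Mor AA)" "g' \<in> carrier (Mor AA)" "tgt AA f' = src AA g'"
  then show "cmp AA (g \<otimes>\<^bsub>Mor AA\<^esub> g') (f \<otimes>\<^bsub>Mor AA\<^esub> f') = cmp AA g f \<otimes>\<^bsub>Mor AA\<^esub> cmp AA g' f'"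
    by (cases f; cases g; cases f'; cases g')
      (auto simp: AA_mor_mult_eq is_AA_mor_iff zscale_add_right ac_simps)
qed

lemma strict_2_group_discrete:
  assumes "group G"
  shows "strict_2_group (discrete_2_group G)"
  using assms by (intro strict_2_group.intro) (auto simp: discrete_2_group_def hom_def)

text \<open>Interchange in a one-object 2-group is commutativity of its automorphism group.\<close>

lemma strict_2_group_B:
  assumes "comm_group A"
  shows "strict_2_group (B_2_group A)"
proof -
  interpret comm_group A by fact
  show ?thesis
  proof (rule strict_2_group.intro)
    fix f assume "f \<in> carrier (Mor (B_2_group A))"
    then show "\<exists>g\<in>carrier (Mor (B_2_group A)). src (B_2_group A) g = tgt (B_2_group A) f \<and>
        tgt (B_2_group A) g = src (B_2_group A) f \<and>
        cmp (B_2_group A) g f = idm (B_2_group A) (src (B_2_group A) f) \<and>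
        cmp (B_2_group A) f g = idm (B_2_group A) (tgt (B_2_group A) f)"
      by (intro bexI[of _ "inv\<^bsub>A\<^esub> f"]) (auto simp: B_2_group_def)
  qed (auto simp: B_2_group_def hom_def m_ac is_group)
qed

section \<open>The homotopy groups\<close>

text \<open>The difference of the two \<open>\<eta>\<close> is a cocycle that vanishes on the lattice; as both satisfy the second axiom
  with the same matrix, it is also symmetric when one argument is a lattice vector. A coboundary for it
  is precisely an isomorphism.\<close>

lemma AA_isomorphic_iff:
  "(\<exists>\<beta>. is_AA_mor (x, \<beta>, y)) \<longleftrightarrow> is_AA_obj x \<and> is_AA_obj y \<and> fst x = fst y"
proof
  assume "\<exists>\<beta>. is_AA_mor (x, \<beta>, y)"
  then show "is_AA_obj x \<and> is_AA_obj y \<and> fst x = fst y" by (auto simp: is_AA_mor_iff)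
next
  assume "is_AA_obj x \<and> is_AA_obj y \<and> fst x = fst y"
  then have x: "is_AA_obj x" and y: "is_AA_obj y" and xy: "fst x = fst y" by auto
  define d where "d p = snd y p + - snd x p" for p
  have d1: "smooth_u1 d"
    unfolding d_def by (intro smooth_u1_add smooth_u1_minus is_AA_objD(2) x y)
  have d2: "d (a, b) + d (a + b, c) = d (b, c) + d (a, b + c)" for a b c
    using is_AA_objD(5)[OF x, of a b c] is_AA_objD(5)[OF y, of a b c]
    unfolding d_def by (simp add: algebra_simps)
  have d3: "d (real_vec m, real_vec m') = 0" for m m'
    by (simp add: d_def is_AA_objD(3)[OF x] is_AA_objD(3)[OF y])
  have d4: "d (real_vec m, a) = d (a, real_vec m)" for m a
  proof -
    have diff: "p' + - p = q' + - q" if "p + s = q + t" "p' + s = q' + t" for p q p' q' s t :: u1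
    proof -
      have "p' + - p = (p' + s) - (p + s)" by simp
      also have "\<dots> = (q' + t) - (q + t)" by (simp only: that)
      finally show ?thesis by simp
    qed
    show ?thesis
      unfolding d_def
      by (rule diff[OF is_AA_objD(4)[OF x, of m a] is_AA_objD(4)[OF y, of m a, folded xy]])
  qed
  obtain \<beta> where \<beta>: "smooth_u1 \<beta>" "\<And>m. \<beta> (real_vec m) = 0"
    "\<And>a b. \<beta> a + \<beta> b = d (a, b) + \<beta> (a + b)"
    by (rule lattice_trivial_cocycle_is_coboundary[OF d1 d2 d3 d4]) blast
  have "is_AA_mor (x, \<beta>, y)"
    unfolding is_AA_mor_iff using x y xy \<beta> by (simp add: d_def)
  then show "\<exists>\<beta>. is_AA_mor (x, \<beta>, y)" by blast
qed

lemma iso_rel_AA: "iso_rel AA `` {x} = {y. is_AA_obj x \<and> is_AA_obj y \<and> fst x = fst y}"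
proof -
  have "y \<in> iso_rel AA `` {x} \<longleftrightarrow> is_AA_obj x \<and> is_AA_obj y \<and> fst x = fst y" for y
  proof -
    have "(\<exists>f\<in>carrier (Mor AA). src AA f = x \<and> tgt AA f = y) \<longleftrightarrow> (\<exists>\<beta>. is_AA_mor (x, \<beta>, y))"
    proof
      assume "\<exists>f\<in>carrier (Mor AA). src AA f = x \<and> tgt AA f = y"
      then obtain f where f: "is_AA_mor f" "src AA f = x" "tgt AA f = y" by auto
      obtain x' \<beta> y' where "f = (x', \<beta>, y')" by (metis prod_cases3)
      with f have "is_AA_mor (x, \<beta>, y)" by simp
      then show "\<exists>\<beta>. is_AA_mor (x, \<beta>, y)" by blast
    next
      assume "\<exists>\<beta>. is_AA_mor (x, \<beta>, y)"
      then obtain \<beta> where "is_AA_mor (x, \<beta>, y)" by blast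
      then show "\<exists>f\<in>carrier (Mor AA). src AA f = x \<and> tgt AA f = y"
        by (intro bexI[of _ "(x, \<beta>, y)"]) simp_all
    qed
    then show ?thesis
      unfolding iso_rel_def AA_isomorphic_iff by auto
  qed
  then show ?thesis by blast
qed

text \<open>By \<open>iso_rel_AA\<close> the isomorphism classes are the fibres of the projection to matrices, and by
  \<open>AA_obj_exists\<close> every fibre over the group is nonempty.\<close>

lemma pi0_AA_iso:
  "\<exists>\<phi> \<in> iso (pi0 (AA :: 'n::finite AA_2_group)) O_pm. \<forall>x \<in> carrier (Obj AA). fst x = \<phi> (iso_rel AA `` {x})"
proof -
  define cls where "cls A = {y :: 'n AA_obj. is_AA_obj y \<and> fst y = A}" for A
  define \<phi> where "\<phi> c = the_elem (fst ` c)" for c :: "'n AA_obj set"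
  have rel: "iso_rel AA `` {x} = cls (fst x)" if "is_AA_obj x" for x :: "'n AA_obj"
    using that by (auto simp: iso_rel_AA cls_def)
  have \<phi>: "\<phi> (cls A) = A" if A: "A \<in> carrier O_pm" for A
  proof -
    obtain \<eta> where "is_AA_obj (A, \<eta>)" using AA_obj_exists[OF A] by blast
    then have "fst ` cls A = {A}" by (force simp: cls_def)
    then show ?thesis by (simp add: \<phi>_def)
  qed
  have carrier: "carrier (pi0 (AA :: 'n AA_2_group)) = cls ` carrier O_pm"
  proof -
    have "carrier (pi0 (AA :: 'n AA_2_group)) = cls ` fst ` {x. is_AA_obj x}"
      by (auto simp: pi0_def quotient_def rel)
    moreover have "fst ` {x :: 'n AA_obj. is_AA_obj x} = carrier O_pm"
    proof (intro equalityI subsetI)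
      show "A \<in> fst ` {x :: 'n AA_obj. is_AA_obj x}" if A: "A \<in> carrier O_pm" for A
        by (rule AA_obj_exists[OF A]) force
    qed (auto dest: is_AA_objD(1))
    ultimately show ?thesis by (simp only:)
  qed
  have mult: "cls A \<otimes>\<^bsub>pi0 AA\<^esub> cls B = cls (A ** B)" if A: "A \<in> carrier O_pm" and B: "B \<in> carrier O_pm" for A B
  proof -
    have "iso_rel AA `` {AA_obj_mult x y} = cls (A ** B)" if "x \<in> cls A" "y \<in> cls B" for x y
      using that rel[of "AA_obj_mult x y"] by (simp add: cls_def AA_obj_mult_closed) (simp add: AA_obj_mult_eq)
    moreover have "\<exists>x. x \<in> cls A" "\<exists>y. y \<in> cls B"
      by (rule AA_obj_exists[OF A], force simp: cls_def, rule AA_obj_exists[OF B], force simp: cls_def)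
    ultimately show ?thesis by (auto simp: pi0_def)
  qed
  have "\<phi> \<in> iso (pi0 AA) O_pm"
  proof (rule isoI)
    show "\<phi> \<in> hom (pi0 AA) O_pm"
      unfolding hom_def carrier
      by (auto simp: \<phi> mult O_pm_mult) (simp add: O_pm_def)
    show "bij_betw \<phi> (carrier (pi0 AA)) (carrier O_pm)"
      unfolding carrier by (rule bij_betw_byWitness[where f' = cls]) (auto simp: \<phi>)
  qed
  moreover have "fst x = \<phi> (iso_rel AA `` {x})" if "x \<in> carrier (Obj AA)" for x :: "'n AA_obj"
    using that by (simp add: rel \<phi> is_AA_objD(1))
  ultimately show ?thesis by blast
qed

lemma comm_group_Z: "comm_group (Z_group :: 'n::finite ivec monoid)"
proof (rule comm_groupI)
  fix x :: "'n ivec"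
  show "\<exists>y\<in>carrier Z_group. y \<otimes>\<^bsub>Z_group\<^esub> x = \<one>\<^bsub>Z_group\<^esub>"
    by (rule bexI[of _ "- x"]) (simp_all add: Z_group_def)
qed (simp_all add: Z_group_def ac_simps)

lemma smooth_u1_character: "smooth_u1 (\<lambda>a. mod_Z (real_vec m \<bullet> a))"
  by (intro smooth_u1I smooth_real_on_bounded_linear open_UNIV bounded_linear_inner_right)

lemma character_vanishes_on_lattice: "mod_Z (real_vec m \<bullet> real_vec m') = 0"
  by (auto simp: mod_Z_eq_0_iff inner_vec_def real_vec_def intro!: Ints_sum Ints_mult)

lemma is_AA_mor_character: "is_AA_mor (AA_one, \<lambda>a. mod_Z (real_vec m \<bullet> a), AA_one)"
  by (simp add: is_AA_mor_iff is_AA_obj_one smooth_u1_character character_vanishes_on_lattice mod_Z_add inner_add_right)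

lemma character_inject:
  assumes "\<And>a. mod_Z (real_vec m \<bullet> a) = mod_Z (real_vec m' \<bullet> a)"
  shows "m = m'"
proof (rule ccontr)
  assume "m \<noteq> m'"
  then obtain i where i: "m $ i \<noteq> m' $ i" by (auto simp: vec_eq_iff)
  \<comment> \<open>the test vector is chosen so that the two characters differ by one half there\<close>
  define r :: real where "r = of_int (m $ i - m' $ i)"
  have "r \<noteq> 0" using i by (simp add: r_def)
  have "real_vec m \<bullet> axis i (1 / (2 * r)) - real_vec m' \<bullet> axis i (1 / (2 * r)) \<in> \<int>"
    using assms by (simp only: mod_Z_eq_iff)
  moreover have "real_vec m \<bullet> axis i (1 / (2 * r)) - real_vec m' \<bullet> axis i (1 / (2 * r)) = r * (1 / (2 * r))"
    by (simp only: inner_axis r_def real_vec_def vec_lambda_beta inner_real_def of_int_diff left_diff_distrib)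
  ultimately have "(1 / 2 :: real) \<in> \<int>" using \<open>r \<noteq> 0\<close> by simp
  then show False by (auto elim!: Ints_cases)
qed

lemma pi1_AA_iso: "on_mor AA_incl \<in> iso Z_group (pi1 (AA :: 'n::finite AA_2_group))"
proof (rule isoI)
  let ?F = "on_mor AA_incl :: 'n ivec \<Rightarrow> 'n AA_mor"
  show "?F \<in> hom Z_group (pi1 AA)"
    by (auto simp: hom_def pi1_def Aut_group_def AA_incl_def is_AA_mor_character Z_group_def
        real_vec_add inner_add_left mod_Z_add)
  have "inj ?F"
  proof (rule injI)
    fix m m' assume "?F m = ?F m'"
    then show "m = m'"
      by (intro character_inject) (simp add: AA_incl_def fun_eq_iff)
  qed
  moreover have "?F ` UNIV = carrier (pi1 AA)"
  proof (intro equalityI subsetI)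
    fix f assume "f \<in> carrier (pi1 (AA :: 'n AA_2_group))"
    then obtain \<beta> where f: "f = (AA_one, \<beta>, AA_one)" "is_AA_mor (AA_one, \<beta>, AA_one)"
      by (cases f) (auto simp: pi1_def Aut_group_def)
    then have \<beta>: "smooth_u1 \<beta>" "\<And>a b. \<beta> (a + b) = \<beta> a + \<beta> b" "\<And>m. \<beta> (real_vec m) = 0"
      by (simp_all add: is_AA_mor_iff)
    obtain m where "\<And>a. \<beta> a = mod_Z (real_vec m \<bullet> a)"
      using smooth_u1_hom_vanishing_on_lattice[OF \<beta>] by blast
    then have "f = ?F m" by (simp add: f AA_incl_def fun_eq_iff)
    then show "f \<in> range ?F" by blast
  qed (auto simp: pi1_def Aut_group_def AA_incl_def is_AA_mor_character)
  ultimately show "bij_betw ?F (carrier Z_group) (carrier (pi1 AA))"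
    by (simp add: bij_betw_def Z_group_def)
qed

section \<open>The extension and its action\<close>

theorem strict_2_group_extension_AA:
  "strict_2_group_extension Z_group (AA :: 'n::finite AA_2_group) O_pm AA_incl AA_proj"
proof (intro strict_2_group_extension.intro strict_2_group_hom.intro strict_2_group_hom_axioms.intro
    strict_2_group_extension_axioms.intro strict_2_group_AA strict_2_group_discrete strict_2_group_B
    comm_group_Z group_O_pm pi1_AA_iso)
  show "on_obj AA_incl \<in> hom (Obj (B_2_group Z_group)) (Obj (AA :: 'n AA_2_group))"
    by (auto simp: hom_def AA_incl_def B_2_group_def is_AA_obj_one AA_obj_mult_one)
  show "on_mor AA_incl \<in> hom (Mor (B_2_group Z_group)) (Mor (AA :: 'n AA_2_group))"
    by (auto simp: hom_def AA_incl_def B_2_group_def Z_group_def is_AA_mor_character AA_mor_mult_eq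
        AA_obj_mult_one real_vec_add inner_add_left mod_Z_add)
      (simp add: AA_one_def O_pm_scalar real_mat_one mod_Z_add)
  show "on_obj AA_proj \<in> hom (Obj (AA :: 'n AA_2_group)) (Obj (discrete_2_group O_pm))"
    by (auto simp: hom_def AA_proj_def discrete_2_group_def AA_obj_mult_def O_pm_def is_AA_obj_def)
  show "on_mor AA_proj \<in> hom (Mor (AA :: 'n AA_2_group)) (Mor (discrete_2_group O_pm))"
    by (auto simp: hom_def AA_proj_def discrete_2_group_def AA_mor_mult_def AA_obj_mult_def O_pm_def
        is_AA_mor_def is_AA_obj_def)
  show "\<exists>\<phi>\<in>iso (pi0 (AA :: 'n AA_2_group)) O_pm. \<forall>x\<in>carrier (Obj AA). on_obj AA_proj x = \<phi> (iso_rel AA `` {x})"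
    using pi0_AA_iso by (simp add: AA_proj_def case_prod_beta)
qed (auto simp: AA_incl_def AA_proj_def B_2_group_def discrete_2_group_def AA_idm_def Z_group_def
    real_vec_add real_vec_zero inner_add_left mod_Z_add is_AA_mor_iff zero_u1_def)

text \<open>Multiplying by \<open>x\<close> on the left scales the character by \<open>\<epsilon>\<close>, and multiplying by the inverse of \<open>x\<close> on the
  right precomposes it with the inverse matrix, which moves to the inverse transpose on \<open>m\<close>; the result is
  \<open>I A I m\<close> by \<open>O_pm_inverse\<close>.\<close>

lemma conjugate_character:
  assumes x: "is_AA_obj x"
  shows "idm AA x \<otimes>\<^bsub>Mor AA\<^esub> on_mor AA_incl m \<otimes>\<^bsub>Mor AA\<^esub> idm AA (inv\<^bsub>Obj AA\<^esub> x) =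
    on_mor AA_incl ((I_mat ** fst x ** I_mat) *v m)"
proof -
  let ?A = "fst x" and ?\<epsilon> = "iso_sign (fst x)"
  interpret group "Obj AA" by (rule group_AA_Obj)
  define x' where "x' = inv\<^bsub>Obj AA\<^esub> x"
  have x': "AA_obj_mult x x' = AA_one" using r_inv[of x] x by (simp add: x'_def)
  obtain A' where A': "A' ** ?A = mat 1" and adj: "mat ?\<epsilon> ** transpose A' = I_mat ** ?A ** I_mat"
    using O_pm_inverse[OF is_AA_objD(1)[OF x]] by blast
  have "fst x' = A' ** ?A ** fst x'" by (simp add: A')
  also have "\<dots> = A' ** (?A ** fst x')" by (simp only: matrix_mul_assoc)
  also have "?A ** fst x' = mat 1" using x' by (simp add: AA_obj_mult_eq AA_one_def)
  finally have fx': "fst x' = A'" by simp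
  have "of_int ?\<epsilon> * (real_vec m \<bullet> (real_mat A' *v a)) = real_vec ((I_mat ** ?A ** I_mat) *v m) \<bullet> a" for a
  proof -
    have "real_vec m \<bullet> (real_mat A' *v a) = (real_mat (transpose A') *v real_vec m) \<bullet> a"
      by (simp add: real_mat_transpose dot_lmul_matrix)
    moreover have "real_vec ((I_mat ** ?A ** I_mat) *v m) =
        of_int ?\<epsilon> *\<^sub>R (real_mat (transpose A') *v real_vec m)"
      by (simp only: adj[symmetric] real_mat_times_real_vec[symmetric] real_mat_mult
          matrix_vector_mul_assoc[symmetric] real_mat_mat)
    ultimately show ?thesis by (simp only: inner_scaleR_left)
  qed
  then show ?thesis
    by (simp add: AA_idm_def AA_incl_def AA_mor_mult_eq AA_obj_mult_one x' fx' zscale_mod_Z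
        flip: x'_def)
qed

text \<open>The definite description needs an object over \<open>A\<close>, for otherwise every vector would satisfy it, and
  faithfulness of the inclusion.\<close>

theorem induced_action_AA:
  assumes A: "A \<in> carrier O_pm"
  shows "induced_action Z_group AA AA_incl AA_proj A m = (I_mat ** A ** I_mat) *v m"
  unfolding induced_action_def
proof (rule the_equality)
  have proj: "on_obj AA_proj x = fst x" for x by (simp add: AA_proj_def case_prod_beta)
  show "(I_mat ** A ** I_mat) *v m \<in> carrier Z_group \<and>
    (\<forall>x\<in>carrier (Obj AA). on_obj AA_proj x = A \<longrightarrow>
      on_mor AA_incl ((I_mat ** A ** I_mat) *v m) =
        idm AA x \<otimes>\<^bsub>Mor AA\<^esub> on_mor AA_incl m \<otimes>\<^bsub>Mor AA\<^esub> idm AA (inv\<^bsub>Obj AA\<^esub> x))"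
  proof (intro conjI ballI impI)
    show "(I_mat ** A ** I_mat) *v m \<in> carrier Z_group" by (simp add: Z_group_def)
    fix x assume "x \<in> carrier (Obj AA)" and "on_obj AA_proj x = A"
    then have x: "is_AA_obj x" and fx: "fst x = A" by (simp_all add: proj)
    show "on_mor AA_incl ((I_mat ** A ** I_mat) *v m) =
        idm AA x \<otimes>\<^bsub>Mor AA\<^esub> on_mor AA_incl m \<otimes>\<^bsub>Mor AA\<^esub> idm AA (inv\<^bsub>Obj AA\<^esub> x)"
      by (rule conjugate_character[OF x, symmetric, unfolded fx])
  qed
  fix b
  assume b: "b \<in> carrier Z_group \<and>
    (\<forall>x\<in>carrier (Obj AA). on_obj AA_proj x = A \<longrightarrow>
      on_mor AA_incl b = idm AA x \<otimes>\<^bsub>Mor AA\<^esub> on_mor AA_incl m \<otimes>\<^bsub>Mor AA\<^esub> idm AA (inv\<^bsub>Obj AA\<^esub> x))"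
  obtain \<eta> where \<eta>: "is_AA_obj (A, \<eta>)" using AA_obj_exists[OF A] by blast
  have "on_mor AA_incl b = idm AA (A, \<eta>) \<otimes>\<^bsub>Mor AA\<^esub> on_mor AA_incl m \<otimes>\<^bsub>Mor AA\<^esub> idm AA (inv\<^bsub>Obj AA\<^esub> (A, \<eta>))"
    by (rule b[THEN conjunct2, THEN bspec, THEN mp]) (simp_all add: \<eta> proj)
  also have "\<dots> = on_mor AA_incl ((I_mat ** A ** I_mat) *v m)"
    by (rule conjugate_character[OF \<eta>, unfolded fst_conv])
  finally show "b = (I_mat ** A ** I_mat) *v m"
    by (intro character_inject) (simp add: AA_incl_def fun_eq_iff)
qed

theorem theorem5p2p6:
  shows "strict_2_group_extension Z_group (AA :: 'n::finite AA_2_group) O_pm AA_incl AA_proj \<and>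
    \<not> central_extension Z_group (AA :: 'n AA_2_group) O_pm AA_incl AA_proj \<and>
    (\<forall>A \<in> carrier O_pm. \<forall>m.
       induced_action Z_group (AA :: 'n AA_2_group) AA_incl AA_proj A m = (I_mat ** A ** I_mat) *v m)"
proof (intro conjI ballI allI)
  show "\<not> central_extension Z_group (AA :: 'n AA_2_group) O_pm AA_incl AA_proj"
  proof
    assume central: "central_extension Z_group (AA :: 'n AA_2_group) O_pm AA_incl AA_proj"
    \<comment> \<open>minus the identity lies in the group with sign \<open>+1\<close> and acts by \<open>m \<mapsto> - m\<close>\<close>
    let ?N = "mat (-1) :: 'n imat" and ?m = "(\<chi> i. 1) :: 'n ivec"
    have N: "?N \<in> carrier O_pm" by (simp add: O_pm_scalar)
    have "I_mat ** ?N ** I_mat = ?N"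
      by (simp only: mat_commute[of I_mat] matrix_mul_assoc[symmetric] I_mat_mult_I_mat matrix_mul_rid)
    then have "?N *v ?m = ?m"
      using central N induced_action_AA[OF N, of ?m] by (simp add: central_extension_def Z_group_def)
    then have "(?N *v ?m) $ i = ?m $ i" for i by simp
    then show False
      by (simp add: matrix_vector_mult_def mat_def)
  qed
qed (rule strict_2_group_extension_AA induced_action_AA, assumption?)+

end
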